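(* Let $\Sigma$ be a set. Then $T(\Sigma)$, the set of isomorphism types of non-trivial pruned $\Sigma$-trees equipped with pruned multiplication and the unary operations $+$ and $*$, is a free object in the quasivariety of adequate semigroups (viewed as $(2,1,1)$-algebras), freely generated by the set $\Sigma$ of base trees: for every adequate semigroup $S$ and function $\chi:\Sigma\to S$ there is a unique $(2,1,1)$-morphism $T(\Sigma)\to S$ extending $\chi$.
   Context: Adequate semigroups: for a semigroup $S$ let $S^1=S$ if $S$ is a monoid and otherwise $S$ with an identity adjoined. Define $a\,\mathcal{L}^*\,b$ iff for all $x,y\in S^1$: $ax=ay\Leftrightarrow bx=by$; and $a\,\mathcal{R}^*\,b$ iff for all $x,y\in S^1$: $xa=ya\Leftrightarrow xb=yb$. $S$ is adequate if its idempotents commute and every $\mathcal{L}^*$-class and every $\mathcal{R}^*$-class contains an idempotent (necessarily unique); $x^+$ denotes the idempotent $\mathcal{R}^*$-related to $x$ and $x^*$ the idempotent $\mathcal{L}^*$-related to $x$. Adequate semigroups are $(2,1,1)$-algebras (multiplication, $+$, $*$) and morphisms preserve all three operations. Trees: A $\Sigma$-tree is a finite directed graph whose underlying undirected graph is a tree, edges labelled by elements of $\Sigma$, with distinguished start and end vertices such that there is a (possibly empty) directed path from the start vertex to the end vertex. A tree with one vertex is trivial; a base tree has exactly one edge, with start vertex its initial vertex and end vertex its terminal vertex; the base tree labelled $a$ is identified with $a\in\Sigma$. A morphism $X\to Y$ maps vertices to vertices and edges to edges, preserving initial vertex, terminal vertex and label of edges, and maps start/end vertex of $X$ to start/end vertex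 of $Y$; isomorphisms are morphisms bijective on vertices and edges. A retraction is an idempotent morphism $X\to X$, its image being a retract; $X$ is pruned if it has no non-identity retraction. Every tree $X$ has a pruned retract, unique up to isomorphism, whose isomorphism type is denoted $\overline{X}$. Unpruned operations: $X\times Y$ glues the end vertex of (a copy of) $X$ to the start vertex of (a disjoint copy of) $Y$, with start vertex that of $X$ and end vertex that of $Y$; $X^{(+)}$ is $X$ with end vertex moved to the start vertex; $X^{( * )}$ is $X$ with start vertex moved to the end vertex. Pruned operations: $XY=\overline{X\times Y}$, $X^+=\overline{X^{(+)}}$, $X^*=\overline{X^{( * )}}$. *)

theory Defs
  imports Main
begin

section \<open>Sigma-trees\<close>

text \<open>A tree is represented concretely: a finite set of vertices (natural numbers),
a set of labelled directed edges (initial vertex, label, terminal vertex),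
a start vertex and an end vertex.  Since the underlying undirected graph of a tree
has no parallel edges, identifying an edge with its triple loses nothing.\<close>

record 'a stree =
  sv :: "nat set"
  se :: "(nat \<times> 'a \<times> nat) set"
  ss :: nat
  st :: nat

definition dir_rel :: "'a stree \<Rightarrow> (nat \<times> nat) set" where
  "dir_rel X = {(u, v). \<exists>a. (u, a, v) \<in> se X}"

definition undir_rel :: "'a stree \<Rightarrow> (nat \<times> nat) set" where
  "undir_rel X = dir_rel X \<union> (dir_rel X)\<inverse>"

text \<open>Underlying undirected multigraph is a tree: finite, connected, |E| = |V| - 1;
plus a (possibly empty) directed path from the start to the end vertex.\<close>
definition is_tree :: "'a stree \<Rightarrow> bool" where
  "is_tree X \<longleftrightarrow>
     finite (sv X) \<and> finite (se X) \<and> ss X \<in> sv X \<and> st X \<in> sv X \<and>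
     (\<forall>(u, a, v) \<in> se X. u \<in> sv X \<and> v \<in> sv X) \<and>
     (\<forall>v \<in> sv X. (ss X, v) \<in> (undir_rel X)\<^sup>*) \<and>
     card (se X) + 1 = card (sv X) \<and>
     (ss X, st X) \<in> (dir_rel X)\<^sup>*"

definition is_Sigma_tree :: "'a set \<Rightarrow> 'a stree \<Rightarrow> bool" where
  "is_Sigma_tree Sig X \<longleftrightarrow> is_tree X \<and> (\<forall>(u, a, v) \<in> se X. a \<in> Sig)"

definition emap :: "(nat \<Rightarrow> nat) \<Rightarrow> nat \<times> 'a \<times> nat \<Rightarrow> nat \<times> 'a \<times> nat" where
  "emap f e = (case e of (u, a, v) \<Rightarrow> (f u, a, f v))"

text \<open>A morphism is given by its vertex map; the edge map is then forced
(edge (u,a,v) goes to the edge (f u, a, f v), which must exist).\<close>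
definition tree_hom :: "'a stree \<Rightarrow> 'a stree \<Rightarrow> (nat \<Rightarrow> nat) \<Rightarrow> bool" where
  "tree_hom X Y f \<longleftrightarrow>
     (\<forall>v \<in> sv X. f v \<in> sv Y) \<and> (\<forall>e \<in> se X. emap f e \<in> se Y) \<and>
     f (ss X) = ss Y \<and> f (st X) = st Y"

definition tree_iso :: "'a stree \<Rightarrow> 'a stree \<Rightarrow> bool" where
  "tree_iso X Y \<longleftrightarrow> (\<exists>f. tree_hom X Y f \<and> bij_betw f (sv X) (sv Y) \<and>
                            bij_betw (emap f) (se X) (se Y))"

definition retraction :: "'a stree \<Rightarrow> (nat \<Rightarrow> nat) \<Rightarrow> bool" where
  "retraction X f \<longleftrightarrow> tree_hom X X f \<and> (\<forall>v \<in> sv X. f (f v) = f v)"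

definition retract_img :: "'a stree \<Rightarrow> (nat \<Rightarrow> nat) \<Rightarrow> 'a stree" where
  "retract_img X f = \<lparr>sv = f ` sv X, se = emap f ` se X, ss = ss X, st = st X\<rparr>"

definition pruned :: "'a stree \<Rightarrow> bool" where
  "pruned X \<longleftrightarrow> (\<forall>f. retraction X f \<longrightarrow> (\<forall>v \<in> sv X. f v = v))"

definition pruned_retract :: "'a stree \<Rightarrow> 'a stree \<Rightarrow> bool" where
  "pruned_retract R X \<longleftrightarrow> (\<exists>f. retraction X f \<and> R = retract_img X f) \<and> pruned R"

text \<open>Isomorphism types are represented as isomorphism classes.\<close>
definition iso_class :: "'a stree \<Rightarrow> 'a stree set" where
  "iso_class X = {Y. is_tree Y \<and> tree_iso X Y}"

text \<open>\<open>pbar X\<close>: the isomorphism type of the pruned retract of X.\<close>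
definition pbar :: "'a stree \<Rightarrow> 'a stree set" where
  "pbar X = {Y. is_tree Y \<and> (\<exists>R. pruned_retract R X \<and> tree_iso R Y)}"

definition rep :: "'a stree set \<Rightarrow> 'a stree" where
  "rep A = (SOME X. X \<in> A)"

subsection \<open>Unpruned operations\<close>

text \<open>Disjoint copies: X via v \<mapsto> 2v, Y via v \<mapsto> 2v+1, with the start vertex of Y
glued to (the copy of) the end vertex of X.\<close>
definition glue_right :: "'a stree \<Rightarrow> 'a stree \<Rightarrow> nat \<Rightarrow> nat" where
  "glue_right X Y v = (if v = ss Y then 2 * st X else 2 * v + 1)"

definition tprod_u :: "'a stree \<Rightarrow> 'a stree \<Rightarrow> 'a stree" where
  "tprod_u X Y =
     \<lparr>sv = (\<lambda>v. 2 * v) ` sv X \<union> glue_right X Y ` sv Y,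
      se = emap (\<lambda>v. 2 * v) ` se X \<union> emap (glue_right X Y) ` se Y,
      ss = 2 * ss X,
      st = glue_right X Y (st Y)\<rparr>"

definition tplus_u :: "'a stree \<Rightarrow> 'a stree" where
  "tplus_u X = X\<lparr>st := ss X\<rparr>"

definition tstar_u :: "'a stree \<Rightarrow> 'a stree" where
  "tstar_u X = X\<lparr>ss := st X\<rparr>"

subsection \<open>Pruned operations on isomorphism types\<close>

definition tmult :: "'a stree set \<Rightarrow> 'a stree set \<Rightarrow> 'a stree set" where
  "tmult A B = pbar (tprod_u (rep A) (rep B))"

definition tplus :: "'a stree set \<Rightarrow> 'a stree set" where
  "tplus A = pbar (tplus_u (rep A))"

definition tstar :: "'a stree set \<Rightarrow> 'a stree set" where
  "tstar A = pbar (tstar_u (rep A))"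

text \<open>T(Sigma): isomorphism types of non-trivial pruned Sigma-trees.\<close>
definition Tset :: "'a set \<Rightarrow> 'a stree set set" where
  "Tset Sig = {iso_class X | X. is_Sigma_tree Sig X \<and> pruned X \<and> card (sv X) \<ge> 2}"

definition base_tree :: "'a \<Rightarrow> 'a stree" where
  "base_tree a = \<lparr>sv = {0, 1}, se = {(0, a, 1)}, ss = 0, st = 1\<rparr>"

definition base_type :: "'a \<Rightarrow> 'a stree set" where
  "base_type a = iso_class (base_tree a)"

section \<open>Adequate semigroups (on a carrier set)\<close>

definition semigroup_on :: "'b set \<Rightarrow> ('b \<Rightarrow> 'b \<Rightarrow> 'b) \<Rightarrow> bool" where
  "semigroup_on S m \<longleftrightarrow> (\<forall>x \<in> S. \<forall>y \<in> S. m x y \<in> S) \<and>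
     (\<forall>x \<in> S. \<forall>y \<in> S. \<forall>z \<in> S. m (m x y) z = m x (m y z))"

definition idem :: "'b set \<Rightarrow> ('b \<Rightarrow> 'b \<Rightarrow> 'b) \<Rightarrow> 'b \<Rightarrow> bool" where
  "idem S m e \<longleftrightarrow> e \<in> S \<and> m e e = e"

text \<open>S^1: S itself if S is a monoid, otherwise S with an identity (None) adjoined.\<close>
definition S1 :: "'b set \<Rightarrow> ('b \<Rightarrow> 'b \<Rightarrow> 'b) \<Rightarrow> 'b option set" where
  "S1 S m = (if \<exists>e \<in> S. \<forall>x \<in> S. m e x = x \<and> m x e = x
             then Some ` S else insert None (Some ` S))"

fun rmul1 :: "('b \<Rightarrow> 'b \<Rightarrow> 'b) \<Rightarrow> 'b \<Rightarrow> 'b option \<Rightarrow> 'b" where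
  "rmul1 m a None = a"
| "rmul1 m a (Some x) = m a x"

fun lmul1 :: "('b \<Rightarrow> 'b \<Rightarrow> 'b) \<Rightarrow> 'b option \<Rightarrow> 'b \<Rightarrow> 'b" where
  "lmul1 m None a = a"
| "lmul1 m (Some x) a = m x a"

definition Lstar :: "'b set \<Rightarrow> ('b \<Rightarrow> 'b \<Rightarrow> 'b) \<Rightarrow> 'b \<Rightarrow> 'b \<Rightarrow> bool" where
  "Lstar S m a b \<longleftrightarrow> (\<forall>x \<in> S1 S m. \<forall>y \<in> S1 S m.
      rmul1 m a x = rmul1 m a y \<longleftrightarrow> rmul1 m b x = rmul1 m b y)"

definition Rstar :: "'b set \<Rightarrow> ('b \<Rightarrow> 'b \<Rightarrow> 'b) \<Rightarrow> 'b \<Rightarrow> 'b \<Rightarrow> bool" where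
  "Rstar S m a b \<longleftrightarrow> (\<forall>x \<in> S1 S m. \<forall>y \<in> S1 S m.
      lmul1 m x a = lmul1 m y a \<longleftrightarrow> lmul1 m x b = lmul1 m y b)"

definition adequate :: "'b set \<Rightarrow> ('b \<Rightarrow> 'b \<Rightarrow> 'b) \<Rightarrow> bool" where
  "adequate S m \<longleftrightarrow> semigroup_on S m \<and>
     (\<forall>e f. idem S m e \<longrightarrow> idem S m f \<longrightarrow> m e f = m f e) \<and>
     (\<forall>a \<in> S. \<exists>e. idem S m e \<and> Lstar S m a e) \<and>
     (\<forall>a \<in> S. \<exists>e. idem S m e \<and> Rstar S m a e)"

text \<open>x^+ : the idempotent R*-related to x;  x^* : the idempotent L*-related to x.\<close>
definition aplus :: "'b set \<Rightarrow> ('b \<Rightarrow> 'b \<Rightarrow> 'b) \<Rightarrow> 'b \<Rightarrow> 'b" where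
  "aplus S m a = (THE e. idem S m e \<and> Rstar S m a e)"

definition astar :: "'b set \<Rightarrow> ('b \<Rightarrow> 'b \<Rightarrow> 'b) \<Rightarrow> 'b \<Rightarrow> 'b" where
  "astar S m a = (THE e. idem S m e \<and> Lstar S m a e)"

text \<open>(2,1,1)-morphisms between carriers.\<close>
definition hom211 ::
  "'c set \<Rightarrow> ('c \<Rightarrow> 'c \<Rightarrow> 'c) \<Rightarrow> ('c \<Rightarrow> 'c) \<Rightarrow> ('c \<Rightarrow> 'c) \<Rightarrow>
   'b set \<Rightarrow> ('b \<Rightarrow> 'b \<Rightarrow> 'b) \<Rightarrow> ('b \<Rightarrow> 'b) \<Rightarrow> ('b \<Rightarrow> 'b) \<Rightarrow> ('c \<Rightarrow> 'b) \<Rightarrow> bool" where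
  "hom211 T mT pT sT S m p s \<phi> \<longleftrightarrow>
     (\<forall>A \<in> T. \<phi> A \<in> S) \<and>
     (\<forall>A \<in> T. \<forall>B \<in> T. \<phi> (mT A B) = m (\<phi> A) (\<phi> B)) \<and>
     (\<forall>A \<in> T. \<phi> (pT A) = p (\<phi> A)) \<and>
     (\<forall>A \<in> T. \<phi> (sT A) = s (\<phi> A))"

end

theory Submission
  imports Defs
begin

text \<open>Write \<open>X \<le> Y\<close> if there is a morphism of trees from \<open>X\<close> to \<open>Y\<close>. A pruned tree is a core: its
  endomorphisms are injective, so isomorphism types of pruned trees are the same thing as trees up to
  the equivalence \<open>X \<le> Y \<le> X\<close>, and identities between pruned operations amount to
  exhibiting morphisms between unpruned trees. The relations \<open>\<R>\<^sup>*\<close> and \<open>\<L>\<^sup>*\<close> are computed from the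
  uniqueness of directed paths in a tree: a morphism \<open>X \<times> A \<rightarrow> Y \<times> A\<close> has to respect the gluing vertices.

  For freeness, evaluate a term in the generators in the target semigroup. The idempotent labellings
  \<open>\<sigma>\<close> of the vertices of a tree with \<open>\<sigma> u \<le> (\<chi> a \<sigma> w)\<^sup>+\<close> and \<open>\<sigma> w \<le> (\<sigma> u \<chi> a)\<^sup>*\<close> for each edge
  \<open>(u, a, w)\<close> pull back along morphisms. The tree of a term has a largest such labelling, and the product
  along its trunk is the value of the term. Hence terms with equivalent trees have the same value.\<close>

section \<open>Finite graphs that are trees\<close>

text \<open>The obstacle to freeness is well-definedness: a tree can be built from generators in
  many ways, and pruning identifies trees whose terms look unrelated. No rewriting of one term into
  another is attempted; the value is described through an order that morphisms respect. For a
  morphism \<open>f\<close>, the largest labelling of the target composed with \<open>f\<close> lies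
  below the largest labelling of the source. Given morphisms both ways, these labels agree along the
  trunk, where the composite morphism is the identity. Off the trunk they may differ, but the
  product along the trunk does not see them. The trivial tree is kept as the tree of a term
  \<open>One\<close>, because cutting a nontrivial tree at an edge may leave trivial pieces.
  Accordingly the target semigroup receives a fresh identity. The evaluation there rests on
  equations between products and the unary operations; the cancellation conditions of adequacy serve
  to derive these equations.\<close>

definition darc :: "(nat \<times> 'a \<times> nat) set \<Rightarrow> (nat \<times> nat) set" where
  "darc E = {(u, v). \<exists>a. (u, a, v) \<in> E}"

definition uarc :: "(nat \<times> 'a \<times> nat) set \<Rightarrow> (nat \<times> nat) set" where
  "uarc E = darc E \<union> (darc E)\<inverse>"

definition eres :: "(nat \<times> 'a \<times> nat) set \<Rightarrow> nat set \<Rightarrow> (nat \<times> 'a \<times> nat) set" where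
  "eres E U = {(u, a, v). (u, a, v) \<in> E \<and> u \<in> U \<and> v \<in> U}"

text \<open>The part of \<open>is_tree\<close> that ignores the distinguished vertices: it applies
  to the two sides of a cut and survives moving the start or end vertex.\<close>

definition gtree :: "nat set \<Rightarrow> (nat \<times> 'a \<times> nat) set \<Rightarrow> bool" where
  "gtree V E \<longleftrightarrow> finite V \<and> finite E \<and> (\<forall>(u, a, v) \<in> E. u \<in> V \<and> v \<in> V) \<and>
     (\<forall>u \<in> V. \<forall>v \<in> V. (u, v) \<in> (uarc E)\<^sup>*) \<and> card E + 1 = card V"

lemma dir_rel_eq: "dir_rel X = darc (se X)"
  by (simp add: dir_rel_def darc_def)

lemma undir_rel_eq: "undir_rel X = uarc (se X)"
  by (simp add: undir_rel_def uarc_def dir_rel_eq)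

lemma sym_uarc: "sym (uarc E)"
  by (auto simp: sym_def uarc_def)

lemma uarc_rtrancl_sym: "(u, v) \<in> (uarc E)\<^sup>* \<Longrightarrow> (v, u) \<in> (uarc E)\<^sup>*"
  by (meson symD sym_rtrancl sym_uarc)

lemma uarcE:
  assumes "(u, v) \<in> uarc E"
  obtains a where "(u, a, v) \<in> E" | a where "(v, a, u) \<in> E"
  using assms by (auto simp: uarc_def darc_def)

lemma darcI: "(u, a, v) \<in> E \<Longrightarrow> (u, v) \<in> darc E"
  by (auto simp: darc_def)

lemma uarcI1: "(u, a, v) \<in> E \<Longrightarrow> (u, v) \<in> uarc E"
  and uarcI2: "(u, a, v) \<in> E \<Longrightarrow> (v, u) \<in> uarc E"
  by (auto simp: uarc_def darc_def)

lemma emap_simp [simp]: "emap f (u, a, v) = (f u, a, f v)"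
  by (simp add: emap_def)

lemma rtrancl_map:
  assumes "(u, v) \<in> r\<^sup>*" and "\<And>x y. (x, y) \<in> r \<Longrightarrow> (f x, f y) \<in> s"
  shows "(f u, f v) \<in> s\<^sup>*"
  using assms(1)
proof induction
  case (step y z)
  then show ?case by (meson assms(2) rtrancl.rtrancl_into_rtrancl)
qed simp

lemma darc_map:
  assumes "\<forall>e \<in> E. emap f e \<in> E'"
  shows "(x, y) \<in> darc E \<Longrightarrow> (f x, f y) \<in> darc E'"
  using assms by (force simp: darc_def)

lemma uarc_map:
  assumes "\<forall>e \<in> E. emap f e \<in> E'"
  shows "(x, y) \<in> uarc E \<Longrightarrow> (f x, f y) \<in> uarc E'"
  using darc_map[OF assms] by (auto simp: uarc_def)

lemma rtrancl_leaves:
  assumes "(b, v) \<in> r\<^sup>*" "b \<in> B" "v \<notin> B"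
  shows "\<exists>x y. x \<in> B \<and> y \<notin> B \<and> (x, y) \<in> r"
  using assms by (induction rule: rtrancl_induct) auto

lemma is_tree_gtree:
  "is_tree X \<longleftrightarrow> gtree (sv X) (se X) \<and> ss X \<in> sv X \<and> st X \<in> sv X \<and> (ss X, st X) \<in> (darc (se X))\<^sup>*"
proof -
  have "(\<forall>u \<in> sv X. \<forall>v \<in> sv X. (u, v) \<in> (uarc (se X))\<^sup>*) \<longleftrightarrow> (\<forall>v \<in> sv X. (ss X, v) \<in> (uarc (se X))\<^sup>*)"
    if "ss X \<in> sv X"
    using that by (meson rtrancl_trans uarc_rtrancl_sym)
  then show ?thesis
    unfolding is_tree_def gtree_def dir_rel_eq undir_rel_eq by blast
qed

text \<open>Growing \<open>B\<close> one vertex at a time along a crossing edge uses up a new edge at each step.\<close>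
lemma card_connected_over:
  assumes "finite V" "finite E" "\<forall>(u, a, v) \<in> E. u \<in> V \<and> v \<in> V"
    and "B \<subseteq> V" "\<forall>v \<in> V. \<exists>b \<in> B. (b, v) \<in> (uarc E)\<^sup>*"
  shows "card (V - B) \<le> card (E - eres E B)"
  using assms(4,5)
proof (induction "card (V - B)" arbitrary: B)
  case (Suc n)
  then obtain v where v: "v \<in> V" "v \<notin> B"
    by (metis DiffE card.empty ex_in_conv nat.distinct(1))
  then obtain b where "b \<in> B" "(b, v) \<in> (uarc E)\<^sup>*" using Suc.prems by blast
  then obtain x y where xy: "x \<in> B" "y \<notin> B" "(x, y) \<in> uarc E"
    using rtrancl_leaves v by metis
  have yV: "y \<in> V" using xy(3) assms(3) by (auto elim!: uarcE)
  let ?B = "insert y B"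
  have c: "card (V - B) = Suc (card (V - ?B))"
    using yV xy(2) assms(1) by (metis Diff_iff Diff_insert card_Suc_Diff1 finite_Diff)
  have "card (V - ?B) \<le> card (E - eres E ?B)"
    by (rule Suc.hyps(1)) (use c Suc.hyps(2) Suc.prems yV in auto)
  moreover have "E - eres E ?B \<subset> E - eres E B"
  proof -
    obtain e where "e \<in> E" "e \<notin> eres E B" "e \<in> eres E ?B"
      using xy by (auto elim!: uarcE simp: eres_def)
    moreover have "eres E B \<subseteq> eres E ?B" by (auto simp: eres_def)
    ultimately show ?thesis by blast
  qed
  then have "card (E - eres E ?B) < card (E - eres E B)"
    using assms(2) by (simp add: psubset_card_mono)
  ultimately show ?case using c by linarith
qed simp

lemma card_connected:
  assumes "finite V" "finite E" "\<forall>(u, a, v) \<in> E. u \<in> V \<and> v \<in> V" "r \<in> V"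
    and "\<forall>v \<in> V. (r, v) \<in> (uarc E)\<^sup>*"
  shows "card V \<le> card E + 1"
proof -
  have "card (V - {r}) \<le> card (E - eres E {r})"
    using assms by (intro card_connected_over) auto
  also have "\<dots> \<le> card E" using assms(2) by (simp add: card_mono)
  finally show ?thesis using assms(1,4) by simp
qed

text \<open>Counting replaces any discussion of cycles. A connected graph on n vertices has at least
  n - 1 edges, so deleting an edge of a tree disconnects it; the edges of the two connected sides
  are then so few that both bounds must be attained.\<close>

lemma gtree_cut:
  assumes T: "gtree V E" and e: "(u, a, w) \<in> E"
  obtains U where "U \<subseteq> V" "u \<in> U" "w \<in> V - U"
    "gtree U (eres E U)" "gtree (V - U) (eres E (V - U))"
    "\<And>x b y. (x, b, y) \<in> E \<Longrightarrow> (x, b, y) \<noteq> (u, a, w) \<Longrightarrow> x \<in> U \<longleftrightarrow> y \<in> U"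
proof -
  define F where "F = E - {(u, a, w)}"
  define U where "U = {v \<in> V. (u, v) \<in> (uarc F)\<^sup>*}"
  have fin: "finite V" "finite E" and EV: "\<And>x b y. (x, b, y) \<in> E \<Longrightarrow> x \<in> V \<and> y \<in> V"
    and conn: "\<And>x y. x \<in> V \<Longrightarrow> y \<in> V \<Longrightarrow> (x, y) \<in> (uarc E)\<^sup>*" and cd: "card E + 1 = card V"
    using T by (auto simp: gtree_def)
  have uw: "u \<in> V" "w \<in> V" using EV e by auto
  have FE: "F \<subseteq> E" by (auto simp: F_def)
  have cF: "card E = card F + 1"
    using e fin unfolding F_def by (metis Suc_eq_plus1 card_Suc_Diff1)
  \<comment> \<open>Follow a path from \<open>u\<close>: whenever it uses the deleted edge it lands
    in \<open>u\<close> or \<open>w\<close>, and the path is restarted there.\<close>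
  have reach: "(u, v) \<in> (uarc F)\<^sup>* \<or> (w, v) \<in> (uarc F)\<^sup>*" if "v \<in> V" for v
  proof -
    have "(u, v) \<in> (uarc E)\<^sup>*" using conn uw that by blast
    then show ?thesis
    proof induction
      case (step y z)
      have "(y, z) \<in> uarc F \<or> z = u \<or> z = w"
        using step.hyps(2) by (auto elim!: uarcE simp: F_def uarc_def darc_def)
      then show ?case using step.IH by (meson rtrancl.simps)
    qed simp
  qed
  have closed: "x \<in> U \<longleftrightarrow> y \<in> U" if "(x, b, y) \<in> F" for x b y
    using that EV FE unfolding U_def
    by (auto intro: rtrancl.rtrancl_into_rtrancl uarcI1 uarcI2)
  have wU: "w \<notin> U"
  proof
    assume "w \<in> U"
    then have "(u, v) \<in> (uarc F)\<^sup>*" if "v \<in> V" for v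
      using reach[OF that] by (auto simp: U_def intro: rtrancl_trans)
    then have "card V \<le> card F + 1"
      using fin FE EV uw by (intro card_connected) (auto simp: F_def)
    then show False using cd cF by simp
  qed
  have inU: "(x, y) \<in> (uarc (eres E A))\<^sup>*"
    if "(x, y) \<in> (uarc F)\<^sup>*" "x \<in> A" "A = U \<or> A = V - U" for x y A
  proof -
    have "y \<in> A \<and> (x, y) \<in> (uarc (eres E A))\<^sup>*"
      using that(1)
    proof induction
      case (step y z)
      have "z \<in> A"
        using step that(3) closed EV FE by (auto elim!: uarcE)
      then have "(y, z) \<in> uarc (eres E A)"
        using step FE by (auto simp: uarc_def darc_def eres_def)
      then show ?case using \<open>z \<in> A\<close> step.IH by (meson rtrancl.simps)
    qed (use that in simp)
    then show ?thesis ..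
  qed
  have UV: "U \<subseteq> V" "u \<in> U" using uw by (auto simp: U_def)
  have fe: "finite (eres E A)" for A
    by (rule finite_subset[OF _ fin(2)]) (auto simp: eres_def)
  have cU: "\<forall>v \<in> U. (u, v) \<in> (uarc (eres E U))\<^sup>*"
    using inU[of u _ U] UV(2) unfolding U_def by blast
  have cW: "\<forall>v \<in> V - U. (w, v) \<in> (uarc (eres E (V - U)))\<^sup>*"
    using inU[of w _ "V - U"] reach wU uw unfolding U_def by blast
  have sub: "\<forall>(x, b, y) \<in> eres E A. x \<in> A \<and> y \<in> A" for A
    by (auto simp: eres_def)
  have fU: "finite U" "finite (V - U)" using fin UV by (auto intro: finite_subset)
  have b1: "card U \<le> card (eres E U) + 1"
    by (rule card_connected[OF fU(1) fe sub UV(2) cU])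
  have b2: "card (V - U) \<le> card (eres E (V - U)) + 1"
    by (rule card_connected[OF fU(2) fe sub _ cW]) (use uw wU in simp)
  have "eres E U \<union> eres E (V - U) \<subseteq> F"
    using UV wU by (auto simp: eres_def F_def)
  then have "card (eres E U \<union> eres E (V - U)) \<le> card F"
    using fin FE by (meson card_mono finite_subset)
  moreover have "card (eres E U \<union> eres E (V - U)) = card (eres E U) + card (eres E (V - U))"
    by (rule card_Un_disjoint[OF fe fe]) (auto simp: eres_def)
  moreover have "card V = card U + card (V - U)"
    using card_Diff_subset[OF fU(1) UV(1)] card_mono[OF fin(1) UV(1)] by simp
  ultimately have eq: "card (eres E U) + 1 = card U" "card (eres E (V - U)) + 1 = card (V - U)"
    using b1 b2 cd cF by linarith+
  have base: "\<forall>x \<in> A. \<forall>y \<in> A. (x, y) \<in> (uarc G)\<^sup>*" if "\<forall>v \<in> A. (r, v) \<in> (uarc G)\<^sup>*"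
    for A r and G :: "(nat \<times> 'a \<times> nat) set"
    using that by (meson rtrancl_trans uarc_rtrancl_sym)
  have g1: "gtree U (eres E U)"
    unfolding gtree_def by (intro conjI fU fe sub base[OF cU] eq)
  have g2: "gtree (V - U) (eres E (V - U))"
    unfolding gtree_def by (intro conjI fU fe sub base[OF cW] eq)
  show thesis
    by (rule that[OF UV _ g1 g2]) (use uw wU closed in \<open>auto simp: F_def\<close>)
qed

text \<open>Every edge other than \<open>(u, a, w)\<close> stays on its side of the cut, and
  \<open>(u, a, w)\<close> itself ends outside \<open>U\<close>, so nothing directed leads into
  \<open>U\<close>.\<close>

lemma cut_forward_closed:
  assumes "(x, v) \<in> (darc E)\<^sup>*" "x \<notin> U"
    and "\<And>x b y. (x, b, y) \<in> E \<Longrightarrow> (x, b, y) \<noteq> (u, a, w) \<Longrightarrow> x \<in> U \<longleftrightarrow> y \<in> U" "w \<notin> U"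
  shows "v \<notin> U"
  using assms(1)
proof induction
  case (step y z)
  then show ?case using assms(3,4) unfolding darc_def by blast
qed (use assms in simp)

lemma cut_crossing:
  assumes "(x, v) \<in> (darc E)\<^sup>*" "x \<in> U" "v \<notin> U"
    and "\<And>x b y. (x, b, y) \<in> E \<Longrightarrow> (x, b, y) \<noteq> (u, a, w) \<Longrightarrow> x \<in> U \<longleftrightarrow> y \<in> U"
  shows "(x, u) \<in> (darc E)\<^sup>* \<and> (w, v) \<in> (darc E)\<^sup>*"
  using assms(1,3)
proof induction
  case (step y z)
  show ?case
  proof (cases "y \<in> U")
    case True
    then have "y = u" "z = w" using assms(4) step.hyps(2) step.prems unfolding darc_def by blast+
    then show ?thesis using step by simp
  next
    case False
    then show ?thesis using step by (meson rtrancl.rtrancl_into_rtrancl)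
  qed
qed (use assms in simp)

lemma gtree_acyclic:
  assumes "gtree V E" "(u, a, w) \<in> E"
  shows "(w, u) \<notin> (darc E)\<^sup>*"
proof
  assume wu: "(w, u) \<in> (darc E)\<^sup>*"
  obtain U where "u \<in> U" "w \<in> V - U"
    "\<And>x b y. (x, b, y) \<in> E \<Longrightarrow> (x, b, y) \<noteq> (u, a, w) \<Longrightarrow> x \<in> U \<longleftrightarrow> y \<in> U"
    by (rule gtree_cut[OF assms]) (rule that)
  then show False using cut_forward_closed[OF wu, of U u a w] by blast
qed

text \<open>Cut at \<open>(u, a, w)\<close>: a different edge \<open>(u, b, w')\<close> stays on the
  side of \<open>u\<close>, so its path to \<open>v\<close> has to come back to \<open>u\<close> to
  use the cut edge, closing a directed cycle.\<close>

lemma gtree_first_edge_unique: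
  assumes T: "gtree V E" and e: "(u, a, w) \<in> E" and e': "(u, b, w') \<in> E"
    and p: "(w, v) \<in> (darc E)\<^sup>*" "(w', v) \<in> (darc E)\<^sup>*"
  shows "a = b \<and> w = w'"
proof (rule ccontr)
  assume ne: "\<not> (a = b \<and> w = w')"
  obtain U where U: "u \<in> U" "w \<in> V - U"
    "\<And>x b y. (x, b, y) \<in> E \<Longrightarrow> (x, b, y) \<noteq> (u, a, w) \<Longrightarrow> x \<in> U \<longleftrightarrow> y \<in> U"
    by (rule gtree_cut[OF T e]) (rule that)
  have "v \<notin> U" using cut_forward_closed[OF p(1), of U u a w] U by blast
  moreover have "w' \<in> U" using U(3)[OF e'] U(1) ne by auto
  ultimately have "(w', u) \<in> (darc E)\<^sup>*" using cut_crossing[OF p(2), of U u a w] U by blast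
  then show False using gtree_acyclic[OF T e'] by blast
qed

text \<open>After the cut at \<open>(w, a, v)\<close> the path from \<open>u\<close> to
  \<open>w'\<close> must run through \<open>v\<close>, and \<open>(w', b, v)\<close> closes a
  directed cycle.\<close>

lemma gtree_last_edge_unique:
  assumes T: "gtree V E" and e: "(w, a, v) \<in> E" and e': "(w', b, v) \<in> E"
    and p: "(u, w) \<in> (darc E)\<^sup>*" "(u, w') \<in> (darc E)\<^sup>*"
  shows "a = b \<and> w = w'"
proof (rule ccontr)
  assume ne: "\<not> (a = b \<and> w = w')"
  obtain U where U: "w \<in> U" "v \<in> V - U"
    "\<And>x c y. (x, c, y) \<in> E \<Longrightarrow> (x, c, y) \<noteq> (w, a, v) \<Longrightarrow> x \<in> U \<longleftrightarrow> y \<in> U"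
    by (rule gtree_cut[OF T e]) (rule that)
  have w': "w' \<notin> U" using U(3)[OF e'] U(2) ne by auto
  have "u \<in> U" using cut_forward_closed[OF p(1), of U w a v] U by blast
  then have "(v, w') \<in> (darc E)\<^sup>*" using cut_crossing[OF p(2), of U w a v] U w' by blast
  then show False using gtree_acyclic[OF T e'] by blast
qed

lemma darc_relpow_length_unique:
  assumes T: "gtree V E" and "(u, v) \<in> darc E ^^ n" "(u, v) \<in> darc E ^^ k"
  shows "n = k"
  using assms(2,3)
proof (induction n arbitrary: k u)
  case 0
  show ?case
  proof (cases k)
    case (Suc j)
    then obtain w where "(u, w) \<in> darc E" "(w, v) \<in> darc E ^^ j"
      using 0(2) by (metis relpow_Suc_D2)
    then have "(w, u) \<in> (darc E)\<^sup>*" using 0(1) by (auto intro: relpow_imp_rtrancl)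
    then show ?thesis using gtree_acyclic[OF T] \<open>(u, w) \<in> darc E\<close> by (auto simp: darc_def)
  qed simp
next
  case (Suc n)
  obtain w where w: "(u, w) \<in> darc E" "(w, v) \<in> darc E ^^ n"
    using Suc.prems(1) by (metis relpow_Suc_D2)
  show ?case
  proof (cases k)
    case 0
    then have "(w, u) \<in> (darc E)\<^sup>*" using Suc.prems w by (auto intro: relpow_imp_rtrancl)
    then show ?thesis using gtree_acyclic[OF T] w by (auto simp: darc_def)
  next
    case (Suc j)
    then obtain w' where w': "(u, w') \<in> darc E" "(w', v) \<in> darc E ^^ j"
      using Suc.prems(2) by (metis relpow_Suc_D2)
    have "w = w'"
      using w w' gtree_first_edge_unique[OF T] relpow_imp_rtrancl[OF w(2)] relpow_imp_rtrancl[OF w'(2)]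
      unfolding darc_def by blast
    then show ?thesis using Suc Suc.IH w w' by simp
  qed
qed

text \<open>On the way from \<open>u\<close> to \<open>v\<close> a vertex is determined by its
  distance from \<open>u\<close>. This and its mirror image locate the vertex to which a morphism
  between products sends the gluing vertex.\<close>

lemma darc_relpow_end_unique:
  assumes T: "gtree V E" and "(u, w) \<in> darc E ^^ n" "(u, w') \<in> darc E ^^ n"
    "(w, v) \<in> (darc E)\<^sup>*" "(w', v) \<in> (darc E)\<^sup>*"
  shows "w = w'"
  using assms(2,3)
proof (induction n arbitrary: u)
  case (Suc n)
  obtain x y where x: "(u, x) \<in> darc E" "(x, w) \<in> darc E ^^ n"
    and y: "(u, y) \<in> darc E" "(y, w') \<in> darc E ^^ n"
    using Suc.prems by (metis relpow_Suc_D2)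
  have "(x, v) \<in> (darc E)\<^sup>*" "(y, v) \<in> (darc E)\<^sup>*"
    using x y assms by (meson relpow_imp_rtrancl rtrancl_trans)+
  then have "x = y" using x y gtree_first_edge_unique[OF T] by (auto simp: darc_def)
  then show ?case using Suc.IH x y by simp
qed simp

lemma darc_relpow_start_unique:
  assumes T: "gtree V E" and "(w, v) \<in> darc E ^^ n" "(w', v) \<in> darc E ^^ n"
    "(u, w) \<in> (darc E)\<^sup>*" "(u, w') \<in> (darc E)\<^sup>*"
  shows "w = w'"
  using assms(2,3)
proof (induction n arbitrary: v)
  case (Suc n)
  obtain x y where x: "(x, v) \<in> darc E" "(w, x) \<in> darc E ^^ n"
    and y: "(y, v) \<in> darc E" "(w', y) \<in> darc E ^^ n"
    using Suc.prems by (metis relpow_Suc_E)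
  have "(u, x) \<in> (darc E)\<^sup>*" "(u, y) \<in> (darc E)\<^sup>*"
    using x y assms by (meson relpow_imp_rtrancl rtrancl_trans)+
  then have "x = y" using x y gtree_last_edge_unique[OF T] by (auto simp: darc_def)
  then show ?case using Suc.IH x y by simp
qed simp

section \<open>Morphisms and unpruned operations\<close>

text \<open>Drops the conditions on start and end vertices, which the inclusions of the factors into
  a product do not satisfy. Labellings are pulled back along such maps as well.\<close>

definition ehom :: "'a stree \<Rightarrow> 'a stree \<Rightarrow> (nat \<Rightarrow> nat) \<Rightarrow> bool" where
  "ehom X Y f \<longleftrightarrow> (\<forall>v \<in> sv X. f v \<in> sv Y) \<and> (\<forall>(u, a, v) \<in> se X. (f u, a, f v) \<in> se Y)"

definition tle :: "'a stree \<Rightarrow> 'a stree \<Rightarrow> bool" where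
  "tle X Y \<longleftrightarrow> (\<exists>f. tree_hom X Y f)"

definition heq :: "'a stree \<Rightarrow> 'a stree \<Rightarrow> bool" where
  "heq X Y \<longleftrightarrow> tle X Y \<and> tle Y X"

text \<open>The map out of a product induced by maps on its factors: the universal property of the
  pushout at the gluing vertex. That vertex has an even code and is evaluated by \<open>f\<close>,
  so \<open>g\<close> describes the whole right copy only if \<open>f\<close> and \<open>g\<close>
  agree there. The codomain is arbitrary because labellings are glued in the same way.\<close>

definition tcopair :: "(nat \<Rightarrow> 'c) \<Rightarrow> (nat \<Rightarrow> 'c) \<Rightarrow> nat \<Rightarrow> 'c" where
  "tcopair f g n = (if even n then f (n div 2) else g (n div 2))"

definition trivial_tree :: "'a stree" where
  "trivial_tree = \<lparr>sv = {0}, se = {}, ss = 0, st = 0\<rparr>"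

lemma tree_hom_ehom: "tree_hom X Y f \<longleftrightarrow> ehom X Y f \<and> f (ss X) = ss Y \<and> f (st X) = st Y"
  by (auto simp: tree_hom_def ehom_def emap_def split: prod.splits)

lemma emap_comp: "emap (g \<circ> f) e = emap g (emap f e)"
  by (cases e) simp

lemma ehom_id: "ehom X X id"
  by (auto simp: ehom_def)

lemma ehom_comp: "ehom X Y f \<Longrightarrow> ehom Y Z g \<Longrightarrow> ehom X Z (g \<circ> f)"
  unfolding ehom_def by fastforce

lemma ehom_emap: "ehom X Y f \<Longrightarrow> \<forall>e \<in> se X. emap f e \<in> se Y"
  by (auto simp: ehom_def)

lemma ehom_darc: "ehom X Y f \<Longrightarrow> (u, v) \<in> (darc (se X))\<^sup>* \<Longrightarrow> (f u, f v) \<in> (darc (se Y))\<^sup>*"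
  by (erule rtrancl_map) (rule darc_map[OF ehom_emap])

lemma ehom_uarc: "ehom X Y f \<Longrightarrow> (u, v) \<in> (uarc (se X))\<^sup>* \<Longrightarrow> (f u, f v) \<in> (uarc (se Y))\<^sup>*"
  by (erule rtrancl_map) (rule uarc_map[OF ehom_emap])

lemma tree_hom_comp: "tree_hom X Y f \<Longrightarrow> tree_hom Y Z g \<Longrightarrow> tree_hom X Z (g \<circ> f)"
  by (auto simp: tree_hom_ehom intro: ehom_comp)

lemma tle_refl: "tle X X"
  unfolding tle_def tree_hom_ehom using ehom_id by force

lemma tle_trans [trans]: "tle X Y \<Longrightarrow> tle Y Z \<Longrightarrow> tle X Z"
  unfolding tle_def using tree_hom_comp by blast

lemma heq_refl: "heq X X"
  by (simp add: heq_def tle_refl)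

lemma heq_sym: "heq X Y \<Longrightarrow> heq Y X"
  by (simp add: heq_def)

lemma heq_trans [trans]: "heq X Y \<Longrightarrow> heq Y Z \<Longrightarrow> heq X Z"
  by (meson heq_def tle_trans)

lemma tprod_u_sel [simp]:
  "sv (tprod_u X Y) = (\<lambda>v. 2 * v) ` sv X \<union> glue_right X Y ` sv Y"
  "se (tprod_u X Y) = emap (\<lambda>v. 2 * v) ` se X \<union> emap (glue_right X Y) ` se Y"
  "ss (tprod_u X Y) = 2 * ss X"
  "st (tprod_u X Y) = glue_right X Y (st Y)"
  by (simp_all add: tprod_u_def)

lemma tplus_u_sel [simp]:
  "sv (tplus_u X) = sv X" "se (tplus_u X) = se X" "ss (tplus_u X) = ss X" "st (tplus_u X) = ss X"
  by (simp_all add: tplus_u_def)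

lemma tstar_u_sel [simp]:
  "sv (tstar_u X) = sv X" "se (tstar_u X) = se X" "ss (tstar_u X) = st X" "st (tstar_u X) = st X"
  by (simp_all add: tstar_u_def)

lemma trivial_tree_sel [simp]:
  "sv trivial_tree = {0}" "se trivial_tree = {}" "ss trivial_tree = 0" "st trivial_tree = 0"
  by (simp_all add: trivial_tree_def)

lemma base_tree_sel [simp]:
  "sv (base_tree a) = {0, 1}" "se (base_tree a) = {(0, a, 1)}"
  "ss (base_tree a) = 0" "st (base_tree a) = 1"
  by (simp_all add: base_tree_def)

lemma glue_right_ss [simp]: "glue_right X Y (ss Y) = 2 * st X"
  by (simp add: glue_right_def)

lemma tcopair_left [simp]: "tcopair f g (2 * v) = f v"
  by (simp add: tcopair_def)

lemma tcopair_right [simp]: "f (st X) = g (ss Y) \<Longrightarrow> tcopair f g (glue_right X Y v) = g v"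
  by (simp add: tcopair_def glue_right_def)

lemma ehom_left: "ehom X (tprod_u X Y) (\<lambda>v. 2 * v)"
  by (force simp: ehom_def)

lemma ehom_right: "ehom Y (tprod_u X Y) (glue_right X Y)"
  by (force simp: ehom_def)

lemma ehom_tcopair:
  assumes "ehom X Z f" "ehom Y Z g" "f (st X) = g (ss Y)"
  shows "ehom (tprod_u X Y) Z (tcopair f g)"
  using assms by (force simp: ehom_def emap_def)

lemma tle_prodI:
  assumes "ehom X Z f" "ehom Y Z g" "f (st X) = g (ss Y)" "f (ss X) = ss Z" "g (st Y) = st Z"
  shows "tle (tprod_u X Y) Z"
  unfolding tle_def tree_hom_ehom
  using assms ehom_tcopair[OF assms(1-3)] by (intro exI[of _ "tcopair f g"]) simp

lemma tle_prod_mono: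
  assumes "tle X X'" "tle Y Y'"
  shows "tle (tprod_u X Y) (tprod_u X' Y')"
proof -
  obtain f g where "tree_hom X X' f" "tree_hom Y Y' g" using assms by (auto simp: tle_def)
  then show ?thesis
    by (intro tle_prodI[where f = "(\<lambda>v. 2 * v) \<circ> f" and g = "glue_right X' Y' \<circ> g"])
      (auto simp: tree_hom_ehom intro: ehom_comp ehom_left ehom_right simp del: tprod_u_sel(1,2))
qed

lemma tle_plus_mono: "tle X Y \<Longrightarrow> tle (tplus_u X) (tplus_u Y)"
  and tle_star_mono: "tle X Y \<Longrightarrow> tle (tstar_u X) (tstar_u Y)"
  by (auto simp: tle_def tree_hom_def)

lemma heq_prod: "heq X X' \<Longrightarrow> heq Y Y' \<Longrightarrow> heq (tprod_u X Y) (tprod_u X' Y')"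
  by (simp add: heq_def tle_prod_mono)

lemma heq_plus: "heq X Y \<Longrightarrow> heq (tplus_u X) (tplus_u Y)"
  and heq_star: "heq X Y \<Longrightarrow> heq (tstar_u X) (tstar_u Y)"
  by (simp_all add: heq_def tle_plus_mono tle_star_mono)

lemma heq_prod_assoc: "heq (tprod_u (tprod_u X Y) Z) (tprod_u X (tprod_u Y Z))"
proof -
  let ?P = "tprod_u (tprod_u X Y) Z" and ?Q = "tprod_u X (tprod_u Y Z)"
  have l: "ehom (tprod_u X Y) ?Q (tcopair (\<lambda>v. 2 * v) (glue_right X (tprod_u Y Z) \<circ> (\<lambda>v. 2 * v)))"
    using glue_right_ss[of X "tprod_u Y Z"]
    by (intro ehom_tcopair ehom_left ehom_comp[OF ehom_left ehom_right]) (simp del: glue_right_ss)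
  have r: "ehom (tprod_u Y Z) ?P (tcopair ((\<lambda>v. 2 * v) \<circ> glue_right X Y) (glue_right (tprod_u X Y) Z))"
    by (intro ehom_tcopair ehom_right ehom_comp[OF ehom_right ehom_left]) simp
  have s: "glue_right X (tprod_u Y Z) (2 * ss Y) = 2 * st X"
    using glue_right_ss[of X "tprod_u Y Z"] by simp
  have "tle ?P ?Q"
    by (rule tle_prodI[OF l ehom_comp[OF ehom_right ehom_right]]) (simp_all add: s)
  moreover have "tle ?Q ?P"
    by (rule tle_prodI[OF ehom_comp[OF ehom_left ehom_left] r]) simp_all
  ultimately show ?thesis by (simp add: heq_def)
qed

lemma ehom_trivial: "v \<in> sv X \<Longrightarrow> ehom trivial_tree X (\<lambda>_. v)"
  by (simp add: ehom_def)

lemma heq_trivial_prod: "is_tree X \<Longrightarrow> heq (tprod_u trivial_tree X) X"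
  unfolding heq_def tle_def[of X] tree_hom_ehom
  by (auto intro!: tle_prodI[where g = id, OF ehom_trivial[where v = "ss X"] ehom_id] exI[of _ "glue_right trivial_tree X"]
      ehom_right simp del: tprod_u_sel(1,2) simp: is_tree_def)

lemma heq_prod_trivial: "is_tree X \<Longrightarrow> heq (tprod_u X trivial_tree) X"
  unfolding heq_def tle_def[of X] tree_hom_ehom
  using glue_right_ss[of X trivial_tree]
  by (auto intro!: tle_prodI[where f = id, OF ehom_id ehom_trivial[where v = "st X"]] exI[of _ "\<lambda>v. 2 * v"]
      ehom_left simp del: tprod_u_sel(1,2) glue_right_ss simp: is_tree_def)

text \<open>Folding both copies of \<open>X\<close> onto \<open>X\<close> is a morphism because the
  copies share their start vertex; the inclusion of the right copy goes back.\<close>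

lemma heq_plus_prod: "heq (tprod_u (tplus_u X) X) X"
  unfolding heq_def tle_def[of X] tree_hom_ehom
  by (auto intro!: tle_prodI[where f = id and g = id] exI[of _ "glue_right (tplus_u X) X"]
      ehom_right simp del: tprod_u_sel(1,2)) (auto simp: ehom_def)

lemma heq_prod_star: "heq (tprod_u X (tstar_u X)) X"
proof -
  have "glue_right X (tstar_u X) (st X) = 2 * st X"
    using glue_right_ss[of X "tstar_u X"] by simp
  then show ?thesis
    unfolding heq_def tle_def[of X] tree_hom_ehom
    by (auto intro!: tle_prodI[where f = id and g = id] exI[of _ "\<lambda>v. 2 * v"]
        ehom_left simp del: tprod_u_sel(1,2)) (auto simp: ehom_def)
qed

lemma heq_prod_idem: "ss X = st X \<Longrightarrow> heq (tprod_u X X) X"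
  using heq_plus_prod[of X] by (simp add: tplus_u_def)

text \<open>All distinguished vertices coincide with the gluing vertex, so exchanging the copies is
  a morphism.\<close>

lemma tle_prod_commute: "ss X = st X \<Longrightarrow> ss Y = st Y \<Longrightarrow> tle (tprod_u X Y) (tprod_u Y X)"
  using glue_right_ss[of Y X]
  by (intro tle_prodI[OF ehom_right ehom_left]) (auto simp del: glue_right_ss)

text \<open>The two copies overlap in at most one vertex, and there are at most
  \<open>card (se X) + card (se Y)\<close> edges; connectedness supplies the opposite
  inequality.\<close>

lemma gtree_prod:
  assumes X: "gtree (sv X) (se X)" and Y: "gtree (sv Y) (se Y)" and "st X \<in> sv X" "ss Y \<in> sv Y"
  shows "gtree (sv (tprod_u X Y)) (se (tprod_u X Y))"
proof -
  let ?P = "tprod_u X Y" and ?l = "\<lambda>v::nat. 2 * v" and ?r = "glue_right X Y"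
  have fin: "finite (sv ?P)" "finite (se ?P)" using X Y by (auto simp: gtree_def)
  have EV: "\<forall>(u, a, v) \<in> se ?P. u \<in> sv ?P \<and> v \<in> sv ?P"
    using X Y by (auto simp: gtree_def)
  have base: "2 * st X \<in> sv ?P" using assms by simp
  have l: "(2 * st X, 2 * v) \<in> (uarc (se ?P))\<^sup>*" if "v \<in> sv X" for v
    using X that assms by (intro ehom_uarc[OF ehom_left]) (simp add: gtree_def)
  have "(?r (ss Y), ?r v) \<in> (uarc (se ?P))\<^sup>*" if "v \<in> sv Y" for v
    using Y that assms by (intro ehom_uarc[OF ehom_right]) (simp add: gtree_def)
  with l have conn: "\<forall>v \<in> sv ?P. (2 * st X, v) \<in> (uarc (se ?P))\<^sup>*" by auto
  have "card (se ?P) \<le> card (se X) + card (se Y)"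
    using card_Un_le card_image_le X Y unfolding gtree_def tprod_u_sel
    by (meson add_mono order_trans)
  moreover have "card (sv X) + card (sv Y) \<le> card (sv ?P) + 1"
  proof -
    have i: "inj_on ?l (sv X)" "inj_on ?r (sv Y)" by (auto simp: inj_on_def glue_right_def split: if_splits) presburger+
    have "?l ` sv X \<inter> ?r ` sv Y \<subseteq> {2 * st X}"
      by (auto simp: glue_right_def split: if_splits) presburger+
    then have "card (?l ` sv X \<inter> ?r ` sv Y) \<le> 1" using card_mono[of "{2 * st X}"] by auto
    then show ?thesis
      using card_Un_Int[of "?l ` sv X" "?r ` sv Y"] X Y i
      by (simp add: gtree_def card_image)
  qed
  moreover have "card (se X) + 1 = card (sv X)" "card (se Y) + 1 = card (sv Y)"
    using X Y by (auto simp: gtree_def)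
  moreover have "card (sv ?P) \<le> card (se ?P) + 1"
    by (rule card_connected[OF fin EV base conn])
  ultimately have "card (se ?P) + 1 = card (sv ?P)" by linarith
  moreover have "\<forall>x \<in> sv ?P. \<forall>y \<in> sv ?P. (x, y) \<in> (uarc (se ?P))\<^sup>*"
    using conn by (meson rtrancl_trans uarc_rtrancl_sym)
  ultimately show ?thesis unfolding gtree_def using fin EV by blast
qed

lemma is_tree_prod:
  assumes "is_tree X" "is_tree Y"
  shows "is_tree (tprod_u X Y)"
proof -
  have "(2 * ss X, 2 * st X) \<in> (darc (se (tprod_u X Y)))\<^sup>*"
    using assms by (intro ehom_darc[OF ehom_left]) (simp add: is_tree_gtree)
  moreover have "(glue_right X Y (ss Y), glue_right X Y (st Y)) \<in> (darc (se (tprod_u X Y)))\<^sup>*"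
    using assms by (intro ehom_darc[OF ehom_right]) (simp add: is_tree_gtree)
  ultimately show ?thesis
    using assms gtree_prod[of X Y] unfolding is_tree_gtree by (auto intro: rtrancl_trans)
qed

lemma is_tree_plus: "is_tree X \<Longrightarrow> is_tree (tplus_u X)"
  and is_tree_star: "is_tree X \<Longrightarrow> is_tree (tstar_u X)"
  by (auto simp: is_tree_gtree)

lemma is_tree_trivial: "is_tree trivial_tree"
  by (simp add: is_tree_def)

lemma is_tree_base: "is_tree (base_tree a)"
  by (auto simp: is_tree_def undir_rel_def dir_rel_def)

lemma is_Sigma_tree_prod:
  "is_Sigma_tree Sig X \<Longrightarrow> is_Sigma_tree Sig Y \<Longrightarrow> is_Sigma_tree Sig (tprod_u X Y)"
  by (auto simp: is_Sigma_tree_def is_tree_prod simp del: tprod_u_sel(1))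

lemma is_Sigma_tree_plus: "is_Sigma_tree Sig X \<Longrightarrow> is_Sigma_tree Sig (tplus_u X)"
  and is_Sigma_tree_star: "is_Sigma_tree Sig X \<Longrightarrow> is_Sigma_tree Sig (tstar_u X)"
  by (auto simp: is_Sigma_tree_def is_tree_plus is_tree_star)

lemma is_Sigma_tree_tle: "tle X Y \<Longrightarrow> is_tree X \<Longrightarrow> is_Sigma_tree Sig Y \<Longrightarrow> is_Sigma_tree Sig X"
  by (force simp: is_Sigma_tree_def tle_def tree_hom_ehom ehom_def)

lemma edges_nonempty_iff: "is_tree X \<Longrightarrow> 2 \<le> card (sv X) \<longleftrightarrow> se X \<noteq> {}"
  using card_gt_0_iff[of "se X"] unfolding is_tree_def by linarith

lemma tle_edges: "tle X Y \<Longrightarrow> se X \<noteq> {} \<Longrightarrow> se Y \<noteq> {}"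
  by (fastforce simp: tle_def tree_hom_ehom ehom_def)

lemma heq_edges: "heq X Y \<Longrightarrow> se X \<noteq> {} \<longleftrightarrow> se Y \<noteq> {}"
  using tle_edges by (auto simp: heq_def)

section \<open>Pruned trees as cores\<close>

lemma retract_img_sel [simp]:
  "sv (retract_img X f) = f ` sv X" "se (retract_img X f) = emap f ` se X"
  "ss (retract_img X f) = ss X" "st (retract_img X f) = st X"
  by (simp_all add: retract_img_def)

lemma tree_edge_in: "is_tree X \<Longrightarrow> (u, a, v) \<in> se X \<Longrightarrow> u \<in> sv X \<and> v \<in> sv X"
  by (auto simp: is_tree_def)

lemma tree_ends_in: "is_tree X \<Longrightarrow> ss X \<in> sv X" "is_tree X \<Longrightarrow> st X \<in> sv X"
  by (auto simp: is_tree_def)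

text \<open>The image is connected, which bounds its number of edges from below. For the upper
  bound, reaching the remaining vertices from the image uses up at least as many edges that do not
  have both ends in the image, so few enough are left inside.\<close>

lemma is_tree_retract:
  assumes X: "is_tree X" and r: "retraction X f"
  shows "is_tree (retract_img X f)"
proof -
  let ?R = "retract_img X f"
  have h: "ehom X X f" "f (ss X) = ss X" "f (st X) = st X" and idem: "\<And>v. v \<in> sv X \<Longrightarrow> f (f v) = f v"
    using r by (auto simp: retraction_def tree_hom_ehom)
  have hR: "ehom X ?R f" by (force simp: ehom_def)
  have T: "gtree (sv X) (se X)" and s: "ss X \<in> sv X" "st X \<in> sv X" "(ss X, st X) \<in> (darc (se X))\<^sup>*"
    using X by (auto simp: is_tree_gtree)
  have fin: "finite (sv ?R)" "finite (se ?R)" using T by (auto simp: gtree_def)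
  have sub: "sv ?R \<subseteq> sv X" using h by (auto simp: ehom_def)
  have EV: "\<forall>(u, a, v) \<in> se ?R. u \<in> sv ?R \<and> v \<in> sv ?R" using T by (auto simp: gtree_def)
  have sR: "ss X \<in> sv ?R" "st X \<in> sv ?R" using h s by (metis imageI retract_img_sel(1))+
  have "(f (ss X), f v) \<in> (uarc (se ?R))\<^sup>*" if "v \<in> sv X" for v
    using T s that by (intro ehom_uarc[OF hR]) (simp add: gtree_def)
  then have conn: "\<forall>v \<in> sv ?R. (ss X, v) \<in> (uarc (se ?R))\<^sup>*" using h by auto
  have "card (sv ?R) \<le> card (se ?R) + 1" by (rule card_connected[OF fin EV sR(1) conn])
  moreover have "card (se ?R) + 1 \<le> card (sv ?R)"
  proof -
    have finX: "finite (sv X)" "finite (se X)" and cX: "card (se X) + 1 = card (sv X)"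
      using T by (auto simp: gtree_def)
    have "\<forall>v \<in> sv X. \<exists>b \<in> sv ?R. (b, v) \<in> (uarc (se X))\<^sup>*"
      using T sR(1) s(1) unfolding gtree_def by blast
    moreover have "\<forall>(u, a, v) \<in> se X. u \<in> sv X \<and> v \<in> sv X" using T unfolding gtree_def by blast
    ultimately have "card (sv X - sv ?R) \<le> card (se X - eres (se X) (sv ?R))"
      using finX sub card_connected_over by blast
    moreover have G: "eres (se X) (sv ?R) \<subseteq> se X" by (auto simp: eres_def)
    then have "card (se X - eres (se X) (sv ?R)) = card (se X) - card (eres (se X) (sv ?R))"
      and "card (eres (se X) (sv ?R)) \<le> card (se X)"
      using finX finite_subset card_Diff_subset card_mono by metis+
    moreover have "card (sv X - sv ?R) = card (sv X) - card (sv ?R)"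
      and "card (sv ?R) \<le> card (sv X)"
      using finX fin sub card_Diff_subset card_mono by metis+
    moreover have "se ?R \<subseteq> eres (se X) (sv ?R)"
      using EV ehom_emap[OF h(1)] by (auto simp: eres_def simp del: retract_img_sel(1))
    then have "card (se ?R) \<le> card (eres (se X) (sv ?R))"
      using finX G by (meson card_mono finite_subset)
    ultimately show ?thesis using cX by linarith
  qed
  moreover have "(ss X, st X) \<in> (darc (se ?R))\<^sup>*" using ehom_darc[OF hR s(3)] h by simp
  ultimately show ?thesis
    using fin EV sR conn unfolding is_tree_def undir_rel_eq dir_rel_eq by auto
qed

text \<open>While some retraction moves a vertex, its image has fewer vertices, and a retract of a
  retract is again a retract of \<open>X\<close>.\<close>

lemma pruned_retract_exists:
  assumes "is_tree X"
  shows "\<exists>R. pruned_retract R X \<and> is_tree R"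
  using assms
proof (induction "card (sv X)" arbitrary: X rule: less_induct)
  case less
  show ?case
  proof (cases "pruned X")
    case True
    have "emap id e = e" for e :: "nat \<times> 'a \<times> nat" by (cases e) simp
    then have "X = retract_img X id" by (simp add: retract_img_def)
    moreover have "retraction X id" by (simp add: retraction_def tree_hom_ehom ehom_id)
    ultimately show ?thesis using True less.prems unfolding pruned_retract_def by metis
  next
    case False
    then obtain f v where f: "retraction X f" "v \<in> sv X" "f v \<noteq> v" by (auto simp: pruned_def)
    let ?R = "retract_img X f"
    have fin: "finite (sv X)" using less.prems by (simp add: is_tree_def)
    have hf: "ehom X X f" "f (ss X) = ss X" "f (st X) = st X" and fi: "\<And>v. v \<in> sv X \<Longrightarrow> f (f v) = f v"
      using f by (auto simp: retraction_def tree_hom_ehom)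
    have "sv ?R \<subset> sv X"
    proof -
      have "sv ?R \<subseteq> sv X" using hf by (auto simp: ehom_def)
      moreover have "v \<notin> sv ?R" using fi f by auto
      ultimately show ?thesis using f by blast
    qed
    then have "card (sv ?R) < card (sv X)" using fin psubset_card_mono by blast
    then obtain S where S: "pruned_retract S ?R" "is_tree S"
      using less.hyps is_tree_retract[OF less.prems f(1)] by blast
    then obtain g where g: "retraction ?R g" "S = retract_img ?R g" "pruned S"
      by (auto simp: pruned_retract_def)
    have hg: "ehom ?R ?R g" "g (ss X) = ss X" "g (st X) = st X" and gi: "\<And>v. v \<in> sv ?R \<Longrightarrow> g (g v) = g v"
      using g by (auto simp: retraction_def tree_hom_ehom)
    have ff: "f v = v" if "v \<in> sv ?R" for v using that fi by auto
    have RX: "ehom ?R X id"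
      using hf by (auto simp: ehom_def)
    have XR: "ehom X ?R f" by (force simp: ehom_def)
    have "ehom X X (id \<circ> (g \<circ> f))"
      by (intro ehom_comp[OF _ RX] ehom_comp[OF XR hg(1)])
    \<comment> \<open>The values of \<open>g\<close> lie in the image of \<open>f\<close>, on which
      \<open>f\<close> is the identity.\<close>
    moreover have "g (f (g (f v))) = g (f v)" if "v \<in> sv X" for v
    proof -
      have "g (f v) \<in> sv ?R" "f v \<in> sv ?R" using that hg(1) by (auto simp: ehom_def)
      then show ?thesis using ff gi by metis
    qed
    ultimately have "retraction X (g \<circ> f)"
      using hf hg by (simp add: retraction_def tree_hom_ehom)
    moreover have "S = retract_img X (g \<circ> f)"
      unfolding g(2) by (simp add: retract_img_def image_image emap_comp)
    ultimately show ?thesis using S g by (auto simp: pruned_retract_def)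
  qed
qed

lemma funpow_closed: "(\<And>v. v \<in> V \<Longrightarrow> h v \<in> V) \<Longrightarrow> v \<in> V \<Longrightarrow> (h ^^ n) v \<in> V"
  by (induction n) auto

text \<open>Two powers agree on the finite set, so the powers are eventually periodic; a multiple of
  the period beyond the preperiod is idempotent.\<close>

lemma funpow_idempotent:
  assumes fin: "finite V" and cl: "\<And>v. v \<in> V \<Longrightarrow> h v \<in> V"
  obtains k where "0 < k" "\<And>v. v \<in> V \<Longrightarrow> (h ^^ k) ((h ^^ k) v) = (h ^^ k) v"
proof -
  \<comment> \<open>Powers are cut off outside \<open>V\<close>, so that only finitely many
    functions can occur.\<close>
  define P where "P n = (\<lambda>v. if v \<in> V then (h ^^ n) v else undefined)" for n
  have "range P \<subseteq> {f. \<forall>x. (x \<in> V \<longrightarrow> f x \<in> V) \<and> (x \<notin> V \<longrightarrow> f x = undefined)}"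
    using funpow_closed[of V h] cl by (auto simp: P_def)
  then have "finite (range P)" using finite_set_of_finite_funs[OF fin fin] finite_subset by blast
  then obtain i j where "i < j" "P i = P j"
    using finite_imageD[of P UNIV] infinite_UNIV_nat unfolding inj_on_def
    by (metis UNIV_I linorder_neqE_nat)
  define d where "d = j - i"
  have d: "0 < d" "j = i + d" using \<open>i < j\<close> by (auto simp: d_def)
  have per: "(h ^^ (n + d)) v = (h ^^ n) v" if "v \<in> V" "i \<le> n" for n v
  proof -
    have "(h ^^ j) v = (h ^^ i) v" using fun_cong[OF \<open>P i = P j\<close>, of v] that by (simp add: P_def)
    then have "(h ^^ (n - i)) ((h ^^ j) v) = (h ^^ (n - i)) ((h ^^ i) v)" by simp
    then show ?thesis using that d by (simp flip: funpow_add comp_apply[of "h ^^ _" "h ^^ _"] add: add.commute add.left_commute)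
  qed
  have per2: "(h ^^ (n + m * d)) v = (h ^^ n) v" if "v \<in> V" "i \<le> n" for n m v
  proof (induction m)
    case (Suc m)
    have "n + Suc m * d = n + m * d + d" by simp
    then have "(h ^^ (n + Suc m * d)) v = (h ^^ (n + m * d)) v" using per[of v "n + m * d"] that
      by (simp only: trans_le_add1)
    then show ?case using Suc by simp
  qed simp
  \<comment> \<open>The exponent has to be a multiple of the period \<open>d\<close>, at least
    \<open>i\<close>, and positive even if \<open>i\<close> is 0; hence
    \<open>Suc i * d\<close>.\<close>
  show thesis
  proof (rule that[of "Suc i * d"])
    show "0 < Suc i * d" using d by simp
    fix v assume "v \<in> V"
    moreover have "i \<le> Suc i * d" using d by (cases d) auto
    ultimately show "(h ^^ (Suc i * d)) ((h ^^ (Suc i * d)) v) = (h ^^ (Suc i * d)) v"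
      using per2[of v "Suc i * d" "Suc i"] by (simp add: funpow_add)
  qed
qed

text \<open>An idempotent power of \<open>h\<close> is a retraction and therefore the identity, so
  the preceding power is a left inverse of \<open>h\<close>.\<close>

lemma pruned_endo_inj:
  assumes X: "is_tree X" "pruned X" and h: "tree_hom X X h"
  shows "inj_on h (sv X)"
proof -
  have "\<And>v. v \<in> sv X \<Longrightarrow> h v \<in> sv X" using h by (auto simp: tree_hom_def)
  then obtain k where k: "0 < k" "\<And>v. v \<in> sv X \<Longrightarrow> (h ^^ k) ((h ^^ k) v) = (h ^^ k) v"
    using funpow_idempotent[of "sv X" h] X by (auto simp: is_tree_def)
  have "tree_hom X X (h ^^ n)" for n
  proof (induction n)
    case 0
    show ?case using ehom_id[of X] by (simp add: tree_hom_ehom id_def)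
  next
    case (Suc n)
    then show ?case using tree_hom_comp[OF _ h] by (simp add: comp_def)
  qed
  then have "retraction X (h ^^ k)" using k by (simp add: retraction_def)
  then have "\<And>v. v \<in> sv X \<Longrightarrow> (h ^^ k) v = v" using X by (auto simp: pruned_def)
  moreover obtain j where "k = Suc j" using k by (cases k) auto
  ultimately have "\<And>v. v \<in> sv X \<Longrightarrow> (h ^^ j) (h v) = v" by (simp add: funpow_swap1)
  then show ?thesis by (rule inj_on_inverseI)
qed

text \<open>Both composites are injective, hence so are \<open>f\<close> and \<open>g\<close>, and
  the vertex counts agree; in trees the edge counts then agree as well, which makes \<open>f\<close>
  bijective on edges.\<close>

lemma heq_pruned_iso:
  assumes X: "is_tree X" "pruned X" and Y: "is_tree Y" "pruned Y" and "heq X Y"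
  shows "tree_iso X Y"
proof -
  obtain f g where f: "tree_hom X Y f" and g: "tree_hom Y X g"
    using assms by (auto simp: heq_def tle_def)
  have fin: "finite (sv X)" "finite (sv Y)" "finite (se X)" "finite (se Y)"
    and cd: "card (se X) + 1 = card (sv X)" "card (se Y) + 1 = card (sv Y)"
    using X Y by (auto simp: is_tree_def)
  have i: "inj_on f (sv X)" "inj_on g (sv Y)"
    using pruned_endo_inj[OF X tree_hom_comp[OF f g]] pruned_endo_inj[OF Y tree_hom_comp[OF g f]]
    by (auto dest: inj_on_imageI2)
  have im: "f ` sv X \<subseteq> sv Y" "g ` sv Y \<subseteq> sv X" "emap f ` se X \<subseteq> se Y"
    using f g by (auto simp: tree_hom_def)
  have c: "card (sv X) = card (sv Y)"
    using card_inj_on_le[OF i(1) im(1) fin(2)] card_inj_on_le[OF i(2) im(2) fin(1)] by simp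
  have "bij_betw f (sv X) (sv Y)"
    using i(1) im(1) c fin by (simp add: bij_betw_def card_image card_subset_eq)
  moreover have "inj_on (emap f) (se X)"
    using i(1) tree_edge_in[OF X(1)] by (auto simp: inj_on_def)
  then have "bij_betw (emap f) (se X) (se Y)"
    using im(3) c cd fin by (simp add: bij_betw_def card_image card_subset_eq)
  ultimately show ?thesis using f by (auto simp: tree_iso_def)
qed

lemma tree_iso_inverse:
  assumes "is_tree X" "tree_iso X Y"
  obtains f g where "tree_hom X Y f" "tree_hom Y X g"
    "\<And>v. v \<in> sv X \<Longrightarrow> g (f v) = v" "\<And>v. v \<in> sv Y \<Longrightarrow> f (g v) = v"
proof -
  obtain f where f: "tree_hom X Y f" "bij_betw f (sv X) (sv Y)" "bij_betw (emap f) (se X) (se Y)"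
    using assms by (auto simp: tree_iso_def)
  let ?g = "inv_into (sv X) f"
  have gf: "\<And>v. v \<in> sv X \<Longrightarrow> ?g (f v) = v" and fg: "\<And>v. v \<in> sv Y \<Longrightarrow> f (?g v) = v"
    using f(2) by (auto simp: bij_betw_inv_into_left bij_betw_inv_into_right)
  have "\<forall>e \<in> se Y. emap ?g e \<in> se X"
  proof
    fix e assume "e \<in> se Y"
    then obtain d where "d \<in> se X" "e = emap f d" using f(3) by (metis bij_betw_def imageE)
    then show "emap ?g e \<in> se X"
      using tree_edge_in[OF assms(1)] gf by (cases d) auto
  qed
  moreover have "\<forall>v \<in> sv Y. ?g v \<in> sv X" using f(2) by (metis bij_betw_def inv_into_into)
  moreover have "?g (ss Y) = ss X" "?g (st Y) = st X"
    using f(1) gf tree_ends_in[OF assms(1)] by (metis tree_hom_def)+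
  ultimately have "tree_hom Y X ?g" by (simp add: tree_hom_def)
  then show thesis using that f(1) gf fg by blast
qed

text \<open>A retraction of \<open>Y\<close> conjugated by the isomorphism is a retraction of
  \<open>X\<close>.\<close>

lemma iso_heq_pruned:
  assumes X: "is_tree X" "pruned X" and "tree_iso X Y"
  shows "heq X Y \<and> pruned Y"
proof -
  obtain f g where fg: "tree_hom X Y f" "tree_hom Y X g"
    "\<And>v. v \<in> sv X \<Longrightarrow> g (f v) = v" "\<And>v. v \<in> sv Y \<Longrightarrow> f (g v) = v"
    using tree_iso_inverse assms by blast
  have "r v = v" if r: "retraction Y r" and v: "v \<in> sv Y" for r v
  proof -
    have rY: "tree_hom Y Y r" "\<And>v. v \<in> sv Y \<Longrightarrow> r (r v) = r v" using r by (auto simp: retraction_def)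
    have mem: "\<And>v. v \<in> sv X \<Longrightarrow> f v \<in> sv Y" "\<And>v. v \<in> sv Y \<Longrightarrow> g v \<in> sv X" "\<And>v. v \<in> sv Y \<Longrightarrow> r v \<in> sv Y"
      using fg rY by (auto simp: tree_hom_def)
    have "tree_hom X X (g \<circ> (r \<circ> f))"
      by (intro tree_hom_comp[OF _ fg(2)] tree_hom_comp[OF fg(1) rY(1)])
    then have "retraction X (g \<circ> (r \<circ> f))"
      using rY fg mem by (simp add: retraction_def)
    then have "g (r (f (g v))) = g v" using X mem v by (auto simp: pruned_def)
    then show ?thesis using fg mem v by metis
  qed
  then show ?thesis using fg by (auto simp: heq_def tle_def pruned_def)
qed

text \<open>A uniform name for isomorphism types: for a pruned tree this is its isomorphism class,
  for an arbitrary tree the isomorphism type of its pruned retract. It lets all further computation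
  take place with unpruned trees.\<close>

definition cls :: "'a stree \<Rightarrow> 'a stree set" where
  "cls X = {Y. is_tree Y \<and> pruned Y \<and> heq X Y}"

lemma heq_retract:
  assumes "pruned_retract R X"
  shows "heq X R"
proof -
  obtain f where f: "retraction X f" "R = retract_img X f" using assms by (auto simp: pruned_retract_def)
  then have "tree_hom X R f" by (force simp: retraction_def tree_hom_ehom ehom_def)
  moreover have "tree_hom R X id" using f by (auto simp: retraction_def tree_hom_ehom ehom_def)
  ultimately show ?thesis by (auto simp: heq_def tle_def)
qed

lemma iso_class_cls:
  assumes "is_tree X" "pruned X"
  shows "iso_class X = cls X"
  using assms iso_heq_pruned heq_pruned_iso by (auto simp: iso_class_def cls_def)

lemma pbar_cls:
  assumes X: "is_tree X"
  shows "pbar X = cls X"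
proof -
  have R: "is_tree R \<and> pruned R \<and> heq X R" if "pruned_retract R X" for R
    using that is_tree_retract[OF X] heq_retract by (auto simp: pruned_retract_def)
  obtain R where "pruned_retract R X" using pruned_retract_exists[OF X] by blast
  then have "cls X \<subseteq> pbar X"
    using R[of R] heq_pruned_iso[of R] heq_trans heq_sym unfolding cls_def pbar_def by blast
  moreover have "pbar X \<subseteq> cls X"
    using R iso_heq_pruned heq_trans unfolding cls_def pbar_def by blast
  ultimately show ?thesis by blast
qed

lemma cls_eqI: "heq X Y \<Longrightarrow> cls X = cls Y"
  by (auto simp: cls_def intro: heq_trans heq_sym)

lemma rep_cls:
  assumes "is_tree X"
  shows "rep (cls X) \<in> cls X"
proof -
  obtain R where "pruned_retract R X" "is_tree R" using pruned_retract_exists[OF assms] by blast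
  then have "R \<in> cls X" using heq_retract by (simp add: cls_def pruned_retract_def)
  then show ?thesis unfolding rep_def by (rule someI)
qed

lemma rep_cls_tree: "is_tree X \<Longrightarrow> is_tree (rep (cls X))"
  and rep_cls_heq: "is_tree X \<Longrightarrow> heq (rep (cls X)) X"
  using rep_cls by (auto simp: cls_def heq_def)

lemma cls_eq_iff: "is_tree X \<Longrightarrow> is_tree Y \<Longrightarrow> cls X = cls Y \<longleftrightarrow> heq X Y"
  using rep_cls_heq[of X] rep_cls_heq[of Y] cls_eqI heq_sym heq_trans by metis

text \<open>The chosen representatives are only equivalent to \<open>X\<close> and \<open>Y\<close>,
  which suffices since the unpruned product respects \<open>heq\<close>.\<close>

lemma tmult_cls:
  assumes "is_tree X" "is_tree Y"
  shows "tmult (cls X) (cls Y) = cls (tprod_u X Y)"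
  unfolding tmult_def using assms
  by (simp add: pbar_cls is_tree_prod rep_cls_tree cls_eqI heq_prod rep_cls_heq)

lemma tplus_cls: "is_tree X \<Longrightarrow> tplus (cls X) = cls (tplus_u X)"
  unfolding tplus_def by (simp add: pbar_cls is_tree_plus rep_cls_tree cls_eqI heq_plus rep_cls_heq)

lemma tstar_cls: "is_tree X \<Longrightarrow> tstar (cls X) = cls (tstar_u X)"
  unfolding tstar_def by (simp add: pbar_cls is_tree_star rep_cls_tree cls_eqI heq_star rep_cls_heq)

text \<open>Nontriviality is restated as having an edge, a condition invariant under
  \<open>heq\<close>, whereas the number of vertices is not.\<close>

lemma Tset_cls: "Tset Sig = {cls X | X. is_Sigma_tree Sig X \<and> se X \<noteq> {}}"
proof -
  have "\<exists>Y. cls X = iso_class Y \<and> is_Sigma_tree Sig Y \<and> pruned Y \<and> 2 \<le> card (sv Y)"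
    if X: "is_Sigma_tree Sig X" "se X \<noteq> {}" for X :: "'a stree"
  proof -
    have t: "is_tree X" using X by (simp add: is_Sigma_tree_def)
    let ?Y = "rep (cls X)"
    have Y: "is_tree ?Y" "pruned ?Y" "heq ?Y X"
      using rep_cls[OF t] by (auto simp: cls_def heq_def)
    then have "is_Sigma_tree Sig ?Y" using X is_Sigma_tree_tle by (auto simp: heq_def)
    moreover have "2 \<le> card (sv ?Y)" using X Y heq_edges edges_nonempty_iff by blast
    moreover have "cls X = iso_class ?Y" using Y iso_class_cls cls_eqI by metis
    ultimately show ?thesis using Y by blast
  qed
  then show ?thesis
    unfolding Tset_def is_Sigma_tree_def
    by (auto simp: iso_class_cls edges_nonempty_iff is_Sigma_tree_def)
qed

lemma pruned_base: "pruned (base_tree a)"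
  by (auto simp: pruned_def retraction_def tree_hom_def)

lemma base_type_cls: "base_type a = cls (base_tree a)"
  by (simp add: base_type_def iso_class_cls is_tree_base pruned_base)

section \<open>Adequacy of the semigroup of pruned trees\<close>

lemma ehom_relpow: "ehom X Y f \<Longrightarrow> (u, v) \<in> darc (se X) ^^ n \<Longrightarrow> (f u, f v) \<in> darc (se Y) ^^ n"
proof (induction n arbitrary: v)
  case (Suc n)
  then show ?case using darc_map[OF ehom_emap[OF Suc.prems(1)]] by (auto simp: relcomp_unfold)
qed simp

lemma glue_right_plus [simp]: "glue_right X (tplus_u Y) = glue_right X Y"
  and glue_right_star [simp]: "glue_right (tstar_u X) Y = glue_right X Y"
  by (auto simp: glue_right_def)

lemma prod_paths:
  assumes "is_tree X" "is_tree Y"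
  shows "(ss (tprod_u X Y), 2 * st X) \<in> (darc (se (tprod_u X Y)))\<^sup>*"
    and "(2 * st X, st (tprod_u X Y)) \<in> (darc (se (tprod_u X Y)))\<^sup>*"
proof -
  show "(ss (tprod_u X Y), 2 * st X) \<in> (darc (se (tprod_u X Y)))\<^sup>*"
    using ehom_darc[OF ehom_left[of X Y], of "ss X" "st X"] assms by (simp add: is_tree_gtree)
  show "(2 * st X, st (tprod_u X Y)) \<in> (darc (se (tprod_u X Y)))\<^sup>*"
    using ehom_darc[OF ehom_right[of Y X], of "ss Y" "st Y"] assms by (simp add: is_tree_gtree)
qed

lemma prod_relpow:
  shows "(ss X, st X) \<in> darc (se X) ^^ n \<Longrightarrow> (ss (tprod_u X Y), 2 * st X) \<in> darc (se (tprod_u X Y)) ^^ n"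
    and "(ss Y, st Y) \<in> darc (se Y) ^^ n \<Longrightarrow> (2 * st X, st (tprod_u X Y)) \<in> darc (se (tprod_u X Y)) ^^ n"
  using ehom_relpow[OF ehom_left[of X Y], of "ss X" "st X" n] ehom_relpow[OF ehom_right[of Y X], of "ss Y" "st Y" n]
  by simp_all

text \<open>A morphism respects the trunk, hence the gluing vertex, so it remains a morphism when the end
  vertex is moved there.\<close>
lemma tle_prod_plus:
  assumes X: "is_tree X" and Y: "is_tree Y" and A: "is_tree A"
    and le: "tle (tprod_u X A) (tprod_u Y A)"
  shows "tle (tprod_u X (tplus_u A)) (tprod_u Y (tplus_u A))"
proof -
  let ?P = "tprod_u X A" and ?Q = "tprod_u Y A"
  obtain f where f: "ehom ?P ?Q f" "f (ss ?P) = ss ?Q" "f (st ?P) = st ?Q"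
    using le unfolding tle_def tree_hom_ehom by blast
  have T: "gtree (sv ?Q) (se ?Q)" using is_tree_prod[OF Y A] unfolding is_tree_gtree by blast
  obtain n where n: "(ss A, st A) \<in> darc (se A) ^^ n"
    using A rtrancl_imp_relpow by (metis is_tree_gtree)
  have "f (2 * st X) = 2 * st Y"
  proof (rule darc_relpow_start_unique[OF T])
    show "(f (2 * st X), st ?Q) \<in> darc (se ?Q) ^^ n"
      using ehom_relpow[OF f(1) prod_relpow(2)[OF n]] f(3) by (simp only:)
    show "(2 * st Y, st ?Q) \<in> darc (se ?Q) ^^ n" by (rule prod_relpow(2)[OF n])
    show "(ss ?Q, f (2 * st X)) \<in> (darc (se ?Q))\<^sup>*"
      using ehom_darc[OF f(1) prod_paths(1)[OF X A]] f(2) by (simp only:)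
    show "(ss ?Q, 2 * st Y) \<in> (darc (se ?Q))\<^sup>*" by (rule prod_paths(1)[OF Y A])
  qed
  then have "tree_hom (tprod_u X (tplus_u A)) (tprod_u Y (tplus_u A)) f"
    using f unfolding tree_hom_ehom ehom_def by simp
  then show ?thesis by (auto simp: tle_def)
qed

text \<open>Here the gluing vertex is found by its distance from the start vertex, and the start
  vertex is then moved there.\<close>

lemma tle_star_prod:
  assumes X: "is_tree X" and Y: "is_tree Y" and A: "is_tree A"
    and le: "tle (tprod_u A X) (tprod_u A Y)"
  shows "tle (tprod_u (tstar_u A) X) (tprod_u (tstar_u A) Y)"
proof -
  let ?P = "tprod_u A X" and ?Q = "tprod_u A Y"
  obtain f where f: "ehom ?P ?Q f" "f (ss ?P) = ss ?Q" "f (st ?P) = st ?Q"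
    using le unfolding tle_def tree_hom_ehom by blast
  have T: "gtree (sv ?Q) (se ?Q)" using is_tree_prod[OF A Y] unfolding is_tree_gtree by blast
  obtain n where n: "(ss A, st A) \<in> darc (se A) ^^ n"
    using A rtrancl_imp_relpow by (metis is_tree_gtree)
  have "f (2 * st A) = 2 * st A"
  proof (rule darc_relpow_end_unique[OF T])
    show "(ss ?Q, f (2 * st A)) \<in> darc (se ?Q) ^^ n"
      using ehom_relpow[OF f(1) prod_relpow(1)[OF n]] f(2) by (simp only:)
    show "(ss ?Q, 2 * st A) \<in> darc (se ?Q) ^^ n" by (rule prod_relpow(1)[OF n])
    show "(f (2 * st A), st ?Q) \<in> (darc (se ?Q))\<^sup>*"
      using ehom_darc[OF f(1) prod_paths(2)[OF A X]] f(3) by (simp only:)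
    show "(2 * st A, st ?Q) \<in> (darc (se ?Q))\<^sup>*" by (rule prod_paths(2)[OF A Y])
  qed
  then have "tree_hom (tprod_u (tstar_u A) X) (tprod_u (tstar_u A) Y) f"
    using f unfolding tree_hom_ehom ehom_def by simp
  then show ?thesis by (auto simp: tle_def)
qed

text \<open>The cancellation condition behind R*, with arbitrary trees as multipliers. Passing from
  \<open>A\<close> to \<open>tplus_u A\<close> relies on the uniqueness of paths; the other
  direction multiplies by \<open>A\<close> and folds.\<close>

lemma heq_prod_plus_iff:
  assumes "is_tree X" "is_tree Y" "is_tree A"
  shows "heq (tprod_u X (tplus_u A)) (tprod_u Y (tplus_u A)) \<longleftrightarrow> heq (tprod_u X A) (tprod_u Y A)"
proof
  assume *: "heq (tprod_u X (tplus_u A)) (tprod_u Y (tplus_u A))"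
  have "heq (tprod_u (tprod_u Z (tplus_u A)) A) (tprod_u Z A)" for Z
    by (rule heq_trans[OF heq_prod_assoc heq_prod[OF heq_refl heq_plus_prod]])
  then show "heq (tprod_u X A) (tprod_u Y A)"
    using heq_prod[OF * heq_refl, of A] by (meson heq_sym heq_trans)
qed (use assms tle_prod_plus in \<open>auto simp: heq_def\<close>)

lemma heq_star_prod_iff:
  assumes "is_tree X" "is_tree Y" "is_tree A"
  shows "heq (tprod_u (tstar_u A) X) (tprod_u (tstar_u A) Y) \<longleftrightarrow> heq (tprod_u A X) (tprod_u A Y)"
proof
  assume *: "heq (tprod_u (tstar_u A) X) (tprod_u (tstar_u A) Y)"
  have "heq (tprod_u A (tprod_u (tstar_u A) Z)) (tprod_u A Z)" for Z
    by (rule heq_trans[OF heq_sym[OF heq_prod_assoc] heq_prod[OF heq_prod_star heq_refl]])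
  then show "heq (tprod_u A X) (tprod_u A Y)"
    using heq_prod[OF heq_refl *, of A] by (meson heq_sym heq_trans)
qed (use assms tle_star_prod in \<open>auto simp: heq_def\<close>)

text \<open>The length of the trunk is additive, so it vanishes.\<close>
lemma idem_tree_ends:
  assumes X: "is_tree X" and "heq (tprod_u X X) X"
  shows "ss X = st X"
proof -
  let ?P = "tprod_u X X"
  obtain f where f: "ehom X ?P f" "f (ss X) = ss ?P" "f (st X) = st ?P"
    using assms(2) unfolding heq_def tle_def tree_hom_ehom by blast
  have T: "gtree (sv ?P) (se ?P)" using is_tree_prod[OF X X] unfolding is_tree_gtree by blast
  obtain n where n: "(ss X, st X) \<in> darc (se X) ^^ n"
    using X rtrancl_imp_relpow by (metis is_tree_gtree)
  have "(ss ?P, st ?P) \<in> darc (se ?P) ^^ (n + n)"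
    using prod_relpow(1)[OF n, of X] prod_relpow(2)[OF n, of X] unfolding relpow_add by blast
  moreover have "(ss ?P, st ?P) \<in> darc (se ?P) ^^ n"
    using ehom_relpow[OF f(1) n] f(2,3) by (simp only:)
  ultimately have "n + n = n" by (rule darc_relpow_length_unique[OF T])
  then show ?thesis using n by simp
qed

section \<open>Identities for the unary operations of an adequate semigroup\<close>

locale adequate_semigroup =
  fixes S :: "'b set" and m :: "'b \<Rightarrow> 'b \<Rightarrow> 'b"
  assumes adequate: "adequate S m"
begin

lemma closed: "x \<in> S \<Longrightarrow> y \<in> S \<Longrightarrow> m x y \<in> S"
  and assoc: "x \<in> S \<Longrightarrow> y \<in> S \<Longrightarrow> z \<in> S \<Longrightarrow> m (m x y) z = m x (m y z)"
  and idem_commute: "idem S m e \<Longrightarrow> idem S m f \<Longrightarrow> m e f = m f e"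
  using adequate by (auto simp: adequate_def semigroup_on_def)

lemma idem_in: "idem S m e \<Longrightarrow> e \<in> S"
  by (simp add: idem_def)

text \<open>Eliminates \<open>S1\<close>. If \<open>S\<close> has an identity, the last condition is
  the first one with that identity as \<open>y\<close>; otherwise it is what the adjoined
  \<open>None\<close> contributes.\<close>

lemma Rstar_iff:
  assumes "a \<in> S" "b \<in> S"
  shows "Rstar S m a b \<longleftrightarrow> (\<forall>x \<in> S. \<forall>y \<in> S. m x a = m y a \<longleftrightarrow> m x b = m y b) \<and>
    (\<forall>x \<in> S. m x a = a \<longleftrightarrow> m x b = b)"
proof (cases "\<exists>e \<in> S. \<forall>x \<in> S. m e x = x \<and> m x e = x")
  case True
  then obtain e where "e \<in> S" "\<forall>x \<in> S. m e x = x" by blast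
  then show ?thesis using True assms by (simp add: Rstar_def S1_def) metis
next
  case False
  show ?thesis unfolding Rstar_def S1_def if_not_P[OF False] using eq_commute[of a] eq_commute[of b] by auto
qed

lemma Rstar_mult:
  assumes "a \<in> S" "b \<in> S" "c \<in> S" "Rstar S m a b"
  shows "Rstar S m (m c a) (m c b)"
  using assms(4) unfolding Rstar_iff[OF assms(1,2)] Rstar_iff[OF closed[OF assms(3,1)] closed[OF assms(3,2)]]
  using assms(1-3) by (simp flip: assoc add: closed)

lemma Rstar_trans: "Rstar S m a b \<Longrightarrow> Rstar S m b c \<Longrightarrow> Rstar S m a c"
  and Rstar_sym: "Rstar S m a b \<Longrightarrow> Rstar S m b a"
  by (simp_all add: Rstar_def)

text \<open>\<open>m e e = e\<close> transfers to \<open>m e f = f\<close>, symmetrically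
  \<open>m f e = e\<close>, and idempotents commute.\<close>

lemma Rstar_idem_unique:
  assumes "idem S m e" "idem S m f" "Rstar S m e f"
  shows "e = f"
proof -
  have "m e f = f" "m f e = e"
    using assms Rstar_iff[of e f] by (auto simp: idem_def)
  then show ?thesis using idem_commute[OF assms(1,2)] by simp
qed

lemma aplus_unique:
  assumes "idem S m e" "Rstar S m a e"
  shows "aplus S m a = e"
  unfolding aplus_def
  using assms Rstar_idem_unique Rstar_trans Rstar_sym by (intro the_equality) blast+

lemma aplus_props:
  assumes "a \<in> S"
  shows "idem S m (aplus S m a)" "Rstar S m a (aplus S m a)"
proof -
  obtain e where "idem S m e" "Rstar S m a e" using assms adequate by (auto simp: adequate_def)
  then show "idem S m (aplus S m a)" "Rstar S m a (aplus S m a)" using aplus_unique by simp_all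
qed

lemma aplus_in: "a \<in> S \<Longrightarrow> aplus S m a \<in> S"
  using aplus_props idem_in by blast

lemma aplus_left: "a \<in> S \<Longrightarrow> m (aplus S m a) a = a"
  using aplus_props[of a] Rstar_iff[of a "aplus S m a"] by (auto simp: idem_def)

lemma aplus_idem: "idem S m e \<Longrightarrow> aplus S m e = e"
  by (intro aplus_unique) (simp_all add: Rstar_def)

lemma idem_mult:
  assumes "idem S m e" "idem S m f"
  shows "idem S m (m e f)"
proof -
  have ef: "e \<in> S" "f \<in> S" "m e e = e" "m f f = f" using assms by (auto simp: idem_def)
  have "m (m e f) (m e f) = m (m e f) (m f e)" using idem_commute[OF assms] by simp
  also have "\<dots> = m e (m (m f f) e)" using ef(1,2) by (simp only: assoc closed)
  also have "\<dots> = m e (m e f)" using ef(4) idem_commute[OF assms] by simp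
  also have "\<dots> = m (m e e) f" using ef(1,2) by (simp only: assoc)
  also have "\<dots> = m e f" using ef by simp
  finally show ?thesis using assms by (simp add: idem_def closed)
qed

text \<open>\<open>b\<close> is R*-related to its plus, and R* is a left congruence by
  \<open>Rstar_mult\<close>.\<close>

lemma aplus_mult:
  assumes "a \<in> S" "b \<in> S"
  shows "aplus S m (m a (aplus S m b)) = aplus S m (m a b)"
proof (rule sym, rule aplus_unique)
  show "idem S m (aplus S m (m a (aplus S m b)))" using assms by (simp add: aplus_props closed aplus_in)
  have "Rstar S m (m a b) (m a (aplus S m b))"
    using assms by (intro Rstar_mult) (simp_all add: aplus_in aplus_props)
  then show "Rstar S m (m a b) (aplus S m (m a (aplus S m b)))"
    by (rule Rstar_trans) (use assms in \<open>simp add: aplus_props closed aplus_in\<close>)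
qed

lemma aplus_idem_mult:
  assumes "idem S m e" "b \<in> S"
  shows "aplus S m (m e b) = m e (aplus S m b)"
proof (rule aplus_unique)
  show "idem S m (m e (aplus S m b))" using idem_mult[OF assms(1) aplus_props(1)[OF assms(2)]] .
  show "Rstar S m (m e b) (m e (aplus S m b))"
    using Rstar_mult[OF assms(2) aplus_in[OF assms(2)] idem_in[OF assms(1)] aplus_props(2)[OF assms(2)]] .
qed

end

section \<open>Left-right duality: passing to the opposite multiplication\<close>

lemma S1_dual: "S1 S (\<lambda>x y. m y x) = S1 S m"
  unfolding S1_def by (simp add: conj_commute)

lemma rmul1_dual: "rmul1 (\<lambda>x y. m y x) a x = lmul1 m x a"
  and lmul1_dual: "lmul1 (\<lambda>x y. m y x) x a = rmul1 m a x"
  by (cases x; simp)+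

lemma Rstar_dual: "Rstar S (\<lambda>x y. m y x) = Lstar S m"
  and Lstar_dual: "Lstar S (\<lambda>x y. m y x) = Rstar S m"
  by (simp_all add: fun_eq_iff Rstar_def Lstar_def S1_dual[of S m] rmul1_dual[of m] lmul1_dual[of m])

lemma idem_dual: "idem S (\<lambda>x y. m y x) = idem S m"
  by (simp add: fun_eq_iff idem_def)

lemma aplus_dual: "aplus S (\<lambda>x y. m y x) = astar S m"
  by (simp add: fun_eq_iff aplus_def astar_def Rstar_dual[of S m] idem_dual[of S m])

lemma adequate_dual:
  assumes "adequate S m"
  shows "adequate S (\<lambda>x y. m y x)"
proof -
  have m: "semigroup_on S m" "\<And>e f. idem S m e \<Longrightarrow> idem S m f \<Longrightarrow> m f e = m e f"
    "\<forall>a \<in> S. \<exists>e. idem S m e \<and> Lstar S m a e" "\<forall>a \<in> S. \<exists>e. idem S m e \<and> Rstar S m a e"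
    using assms unfolding adequate_def by metis+
  have "semigroup_on S (\<lambda>x y. m y x)" using m(1) by (simp add: semigroup_on_def)
  then show ?thesis
    unfolding adequate_def Rstar_dual[of S m] Lstar_dual[of S m] idem_dual[of S m] by (intro conjI allI impI m)
qed

context adequate_semigroup
begin

lemma dual: "adequate_semigroup S (\<lambda>x y. m y x)"
  by unfold_locales (rule adequate_dual[OF adequate])

lemmas astar_unique = adequate_semigroup.aplus_unique[OF dual, unfolded aplus_dual[of S m] idem_dual[of S m] Rstar_dual[of S m]]
  and astar_props = adequate_semigroup.aplus_props[OF dual, unfolded aplus_dual[of S m] idem_dual[of S m] Rstar_dual[of S m]]
  and astar_in = adequate_semigroup.aplus_in[OF dual, unfolded aplus_dual[of S m]]
  and astar_right = adequate_semigroup.aplus_left[OF dual, unfolded aplus_dual[of S m]]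
  and astar_idem = adequate_semigroup.aplus_idem[OF dual, unfolded aplus_dual[of S m] idem_dual[of S m]]
  and astar_mult = adequate_semigroup.aplus_mult[OF dual, unfolded aplus_dual[of S m]]
  and astar_mult_idem = adequate_semigroup.aplus_idem_mult[OF dual, unfolded aplus_dual[of S m] idem_dual[of S m]]

end

section \<open>Isomorphism types of pruned trees as an adequate semigroup\<close>

lemma Tset_elim:
  assumes "A \<in> Tset Sig"
  obtains X where "A = cls X" "is_Sigma_tree Sig X" "is_tree X" "se X \<noteq> {}"
  using assms unfolding Tset_cls by (auto simp: is_Sigma_tree_def)

lemma cls_in_Tset: "is_Sigma_tree Sig X \<Longrightarrow> se X \<noteq> {} \<Longrightarrow> cls X \<in> Tset Sig"
  unfolding Tset_cls by auto

lemma Tset_mult: "A \<in> Tset Sig \<Longrightarrow> B \<in> Tset Sig \<Longrightarrow> tmult A B \<in> Tset Sig"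
  by (elim Tset_elim) (simp add: tmult_cls cls_in_Tset is_Sigma_tree_prod)

lemma Tset_plus: "A \<in> Tset Sig \<Longrightarrow> tplus A \<in> Tset Sig"
  and Tset_star: "A \<in> Tset Sig \<Longrightarrow> tstar A \<in> Tset Sig"
  by (elim Tset_elim, simp add: tplus_cls tstar_cls cls_in_Tset is_Sigma_tree_plus is_Sigma_tree_star)+

lemma base_type_in_Tset: "a \<in> Sig \<Longrightarrow> base_type a \<in> Tset Sig"
  unfolding base_type_cls by (intro cls_in_Tset) (simp_all add: is_Sigma_tree_def is_tree_base)

text \<open>The trivial tree, which is excluded from \<open>Tset Sig\<close>, acts as the adjoined
  identity, so both cases reduce to multiplication by a tree.\<close>

lemma S1_tree:
  assumes "x \<in> S1 (Tset Sig) tmult"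
  obtains Z where "is_tree Z" "\<And>X. is_tree X \<Longrightarrow> lmul1 tmult x (cls X) = cls (tprod_u Z X)"
    "\<And>X. is_tree X \<Longrightarrow> rmul1 tmult (cls X) x = cls (tprod_u X Z)"
proof (cases x)
  case None
  then show thesis
    by (intro that[of trivial_tree])
      (simp_all add: is_tree_trivial cls_eqI[OF heq_trivial_prod] cls_eqI[OF heq_prod_trivial])
next
  case (Some A)
  then have "A \<in> Tset Sig" using assms by (auto simp: S1_def split: if_splits)
  then obtain Z where "A = cls Z" "is_tree Z" by (rule Tset_elim)
  then show thesis using that[of Z] Some by (simp add: tmult_cls)
qed

lemma idem_Tset_iff:
  assumes "A \<in> Tset Sig"
  shows "idem (Tset Sig) tmult A \<longleftrightarrow> (\<exists>X. A = cls X \<and> is_tree X \<and> ss X = st X)"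
  using assms
proof (rule Tset_elim)
  fix X assume X: "A = cls X" "is_tree X"
  have "idem (Tset Sig) tmult A \<longleftrightarrow> heq (tprod_u X X) X"
    using X assms by (simp add: idem_def tmult_cls cls_eq_iff is_tree_prod)
  moreover have "tmult A A = A" if "A = cls Y" "is_tree Y" "ss Y = st Y" for Y
    using that by (simp add: tmult_cls cls_eqI[OF heq_prod_idem])
  ultimately show ?thesis using idem_tree_ends X assms by (auto simp: idem_def)
qed

lemma idem_plus: "A \<in> Tset Sig \<Longrightarrow> idem (Tset Sig) tmult (tplus A)"
proof -
  assume A: "A \<in> Tset Sig"
  then obtain X where "A = cls X" "is_tree X" by (rule Tset_elim)
  then have "tplus A = cls (tplus_u X) \<and> is_tree (tplus_u X) \<and> ss (tplus_u X) = st (tplus_u X)"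
    by (simp add: tplus_cls is_tree_plus)
  then show ?thesis using idem_Tset_iff[OF Tset_plus[OF A]] by blast
qed

lemma idem_star: "A \<in> Tset Sig \<Longrightarrow> idem (Tset Sig) tmult (tstar A)"
proof -
  assume A: "A \<in> Tset Sig"
  then obtain X where "A = cls X" "is_tree X" by (rule Tset_elim)
  then have "tstar A = cls (tstar_u X) \<and> is_tree (tstar_u X) \<and> ss (tstar_u X) = st (tstar_u X)"
    by (simp add: tstar_cls is_tree_star)
  then show ?thesis using idem_Tset_iff[OF Tset_star[OF A]] by blast
qed

lemma Rstar_plus:
  assumes "A \<in> Tset Sig"
  shows "Rstar (Tset Sig) tmult A (tplus A)"
proof -
  obtain X where X: "A = cls X" "is_tree X" using assms by (rule Tset_elim)
  show ?thesis
    unfolding Rstar_def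
  proof (intro ballI)
    fix x y assume "x \<in> S1 (Tset Sig) tmult" "y \<in> S1 (Tset Sig) tmult"
    then obtain Z W where Z: "is_tree Z" "\<And>X. is_tree X \<Longrightarrow> lmul1 tmult x (cls X) = cls (tprod_u Z X)"
      and W: "is_tree W" "\<And>X. is_tree X \<Longrightarrow> lmul1 tmult y (cls X) = cls (tprod_u W X)"
      by (meson S1_tree)
    show "lmul1 tmult x A = lmul1 tmult y A \<longleftrightarrow> lmul1 tmult x (tplus A) = lmul1 tmult y (tplus A)"
      using X Z W heq_prod_plus_iff[of Z W X]
      by (simp add: tplus_cls is_tree_plus cls_eq_iff is_tree_prod)
  qed
qed

lemma Lstar_star:
  assumes "A \<in> Tset Sig"
  shows "Lstar (Tset Sig) tmult A (tstar A)"
proof -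
  obtain X where X: "A = cls X" "is_tree X" using assms by (rule Tset_elim)
  show ?thesis
    unfolding Lstar_def
  proof (intro ballI)
    fix x y assume "x \<in> S1 (Tset Sig) tmult" "y \<in> S1 (Tset Sig) tmult"
    then obtain Z W where Z: "is_tree Z" "\<And>X. is_tree X \<Longrightarrow> rmul1 tmult (cls X) x = cls (tprod_u X Z)"
      and W: "is_tree W" "\<And>X. is_tree X \<Longrightarrow> rmul1 tmult (cls X) y = cls (tprod_u X W)"
      by (meson S1_tree)
    show "rmul1 tmult A x = rmul1 tmult A y \<longleftrightarrow> rmul1 tmult (tstar A) x = rmul1 tmult (tstar A) y"
      using X Z W heq_star_prod_iff[of Z W X]
      by (simp add: tstar_cls is_tree_star cls_eq_iff is_tree_prod)
  qed
qed

lemma adequate_Tset: "adequate (Tset Sig) tmult"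
  unfolding adequate_def
proof (intro conjI allI impI ballI)
  show "semigroup_on (Tset Sig) tmult"
    unfolding semigroup_on_def
  proof (intro conjI ballI)
    fix A B C assume "A \<in> Tset Sig" "B \<in> Tset Sig" "C \<in> Tset Sig"
    then show "tmult (tmult A B) C = tmult A (tmult B C)"
      by (elim Tset_elim) (simp add: tmult_cls is_tree_prod cls_eqI[OF heq_prod_assoc])
  qed (rule Tset_mult)
next
  fix A B assume AB: "idem (Tset Sig) tmult A" "idem (Tset Sig) tmult B"
  then obtain X Y where X: "A = cls X" "is_tree X" "ss X = st X" and Y: "B = cls Y" "is_tree Y" "ss Y = st Y"
    using idem_Tset_iff by (metis idem_def)
  have "heq (tprod_u X Y) (tprod_u Y X)"
    using X Y by (simp add: heq_def tle_prod_commute)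
  then show "tmult A B = tmult B A"
    using X Y cls_eqI by (simp add: tmult_cls)
qed (use idem_plus idem_star Rstar_plus Lstar_star in blast)+

interpretation Tset: adequate_semigroup "Tset Sig" tmult for Sig
  by unfold_locales (rule adequate_Tset)

lemma aplus_Tset: "A \<in> Tset Sig \<Longrightarrow> aplus (Tset Sig) tmult A = tplus A"
  by (intro Tset.aplus_unique idem_plus Rstar_plus)

lemma astar_Tset: "A \<in> Tset Sig \<Longrightarrow> astar (Tset Sig) tmult A = tstar A"
  by (intro Tset.astar_unique idem_star Lstar_star)

section \<open>Terms\<close>

datatype 'a trm = One | Gen 'a | Mul "'a trm" "'a trm" | Plus "'a trm" | Star "'a trm"

primrec den :: "'a trm \<Rightarrow> 'a stree" where
  "den One = trivial_tree"
| "den (Gen a) = base_tree a"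
| "den (Mul s t) = tprod_u (den s) (den t)"
| "den (Plus t) = tplus_u (den t)"
| "den (Star t) = tstar_u (den t)"

lemma is_tree_den: "is_tree (den t)"
  by (induction t)
    (simp_all add: is_tree_trivial is_tree_base is_tree_prod is_tree_plus is_tree_star del: tprod_u_sel)

lemma is_Sigma_tree_den: "set_trm t \<subseteq> Sig \<Longrightarrow> is_Sigma_tree Sig (den t)"
proof (induction t)
  case (Mul s t)
  then show ?case using is_Sigma_tree_prod by simp
next
  case (Plus t)
  then show ?case using is_Sigma_tree_plus by simp
next
  case (Star t)
  then show ?case using is_Sigma_tree_star by simp
qed (simp_all add: is_Sigma_tree_def is_tree_trivial is_tree_base)

lemma edgeless_heq_trivial:
  assumes "is_tree X" "se X = {}"
  shows "heq trivial_tree X"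
proof -
  have "card (sv X) = 1" using assms by (simp add: is_tree_def)
  then have "st X = ss X"
    using tree_ends_in[OF assms(1)] by (auto simp: card_1_singleton_iff)
  then have "tree_hom trivial_tree X (\<lambda>_. ss X)" "tree_hom X trivial_tree (\<lambda>_. 0)"
    using assms tree_ends_in[OF assms(1)] by (simp_all add: tree_hom_def)
  then show ?thesis by (auto simp: heq_def tle_def)
qed

text \<open>The two sides of the cut at the first trunk edge become factors: the side of the start
  vertex gives \<open>C\<close>, whose distinguished vertices coincide, and \<open>D\<close> carries
  the rest of the trunk.\<close>

lemma tree_split:
  assumes X: "is_tree X" and e: "(ss X, a, w) \<in> se X" and p: "(w, st X) \<in> (darc (se X))\<^sup>*"
  obtains C D where "is_tree C" "is_tree D" "card (sv C) < card (sv X)" "card (sv D) < card (sv X)"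
    "se C \<subseteq> se X" "se D \<subseteq> se X" "heq (tprod_u (tprod_u C (base_tree a)) D) X"
proof -
  have T: "gtree (sv X) (se X)" using X by (simp add: is_tree_gtree)
  obtain U where U: "U \<subseteq> sv X" "ss X \<in> U" "w \<in> sv X - U"
    and g: "gtree U (eres (se X) U)" "gtree (sv X - U) (eres (se X) (sv X - U))"
    and cl: "\<And>x b y. (x, b, y) \<in> se X \<Longrightarrow> (x, b, y) \<noteq> (ss X, a, w) \<Longrightarrow> x \<in> U \<longleftrightarrow> y \<in> U"
    by (rule gtree_cut[OF T e]) (rule that)
  let ?W = "sv X - U"
  define C where "C = \<lparr>sv = U, se = eres (se X) U, ss = ss X, st = ss X\<rparr>"
  define D where "D = \<lparr>sv = ?W, se = eres (se X) ?W, ss = w, st = st X\<rparr>"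
  have Cs [simp]: "sv C = U" "se C = eres (se X) U" "ss C = ss X" "st C = ss X"
    and Ds [simp]: "sv D = ?W" "se D = eres (se X) ?W" "ss D = w" "st D = st X"
    by (simp_all add: C_def D_def)
  have pD: "st X \<in> ?W \<and> (w, st X) \<in> (darc (eres (se X) ?W))\<^sup>*"
    using p
  proof induction
    case (step y z)
    then obtain b where yz: "(y, b, z) \<in> se X" by (auto simp: darc_def)
    have "z \<in> ?W" using cl[OF yz] step.IH U tree_edge_in[OF X yz] by auto
    moreover have "(y, z) \<in> darc (eres (se X) ?W)"
      using yz step.IH \<open>z \<in> ?W\<close> by (auto simp: darc_def eres_def)
    ultimately show ?case using step.IH by (meson rtrancl.rtrancl_into_rtrancl)
  qed (use U in simp)
  have C: "is_tree C" using g U by (simp add: is_tree_gtree)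
  have D: "is_tree D" using g U pD by (simp add: is_tree_gtree)
  have fin: "finite (sv X)" using X by (simp add: is_tree_def)
  have "card (sv C) < card (sv X)" "card (sv D) < card (sv X)"
    using U fin by (auto intro!: psubset_card_mono)
  moreover have "se C \<subseteq> se X" "se D \<subseteq> se X" by (auto simp: eres_def)
  moreover have "heq (tprod_u (tprod_u C (base_tree a)) D) X"
  proof -
    let ?B = "base_tree a"
    let ?Q = "tprod_u C ?B"
    let ?P = "tprod_u ?Q D"
    let ?g = "\<lambda>n::nat. if n = 0 then ss X else w"
    have CX: "ehom C X id" "ehom D X id" using U by (auto simp: ehom_def eres_def)
    have "ehom ?B X ?g" using e U by (auto simp: ehom_def)
    then have "ehom ?Q X (tcopair id ?g)" by (intro ehom_tcopair CX) simp_all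
    moreover have stQ: "tcopair id ?g (st ?Q) = w"
      using tcopair_right[of id C ?g ?B 1] by simp
    ultimately have 1: "tle ?P X" by (intro tle_prodI[where f = "tcopair id ?g", OF _ CX(2)]) simp_all
    \<comment> \<open>In the nested product \<open>2 * (2 * v)\<close> is the code of the copy of
      \<open>v\<close> in \<open>C\<close>; as the start vertex of \<open>D\<close>,
      \<open>w\<close> goes to the second gluing vertex.\<close>
    define h where "h v = (if v \<in> U then 2 * (2 * v) else glue_right ?Q D v)" for v
    have B: "glue_right C ?B 0 = 2 * ss X" using glue_right_ss[of C ?B] by simp
    have lC: "ehom C ?P (\<lambda>v. 2 * (2 * v))"
      using ehom_comp[OF ehom_left ehom_left] by (simp add: comp_def)
    have lB: "ehom ?B ?P (\<lambda>v. 2 * glue_right C ?B v)"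
      using ehom_comp[OF ehom_right ehom_left] by (simp add: comp_def)
    have rD: "ehom D ?P (glue_right ?Q D)" by (rule ehom_right)
    have hw: "h w = 2 * glue_right C ?B 1" using U glue_right_ss[of ?Q D] by (simp add: h_def)
    have "h v \<in> sv ?P" if "v \<in> sv X" for v
      using that lC rD U by (simp add: h_def ehom_def)
    moreover have "(h x, b, h y) \<in> se ?P" if xy: "(x, b, y) \<in> se X" for x b y
    proof (cases "(x, b, y) = (ss X, a, w)")
      case True
      have "(2 * glue_right C ?B 0, a, 2 * glue_right C ?B 1) \<in> se ?P"
        using lB unfolding ehom_def by simp
      then show ?thesis using True hw B U by (simp add: h_def del: tprod_u_sel)
    next
      case False
      have V: "x \<in> sv X" "y \<in> sv X" using tree_edge_in[OF X xy] by auto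
      show ?thesis
      proof (cases "x \<in> U")
        case True
        then have "(x, b, y) \<in> se C" using cl[OF xy False] xy by (simp add: eres_def)
        then have "(2 * (2 * x), b, 2 * (2 * y)) \<in> se ?P" using lC unfolding ehom_def by blast
        then show ?thesis using True cl[OF xy False] by (simp add: h_def del: tprod_u_sel)
      next
        case F: False
        then have "(x, b, y) \<in> se D" using cl[OF xy False] xy V by (simp add: eres_def)
        then have "(glue_right ?Q D x, b, glue_right ?Q D y) \<in> se ?P" using rD unfolding ehom_def by blast
        then show ?thesis using F cl[OF xy False] by (simp add: h_def del: tprod_u_sel)
      qed
    qed
    ultimately have "ehom X ?P h" unfolding ehom_def by blast
    moreover have "h (ss X) = ss ?P" "h (st X) = st ?P" using U pD by (simp_all add: h_def)
    ultimately have "tle X ?P" unfolding tle_def tree_hom_ehom by blast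
    with 1 show ?thesis by (simp add: heq_def)
  qed
  ultimately show thesis using that C D by blast
qed

text \<open>A trunk with an edge allows a splitting into smaller trees. If start and end vertex
  coincide, one of them is moved along an incident edge to create a trunk, and \<open>Plus\<close>
  or \<open>Star\<close> moves it back.\<close>

lemma den_complete:
  assumes "is_Sigma_tree Sig X"
  shows "\<exists>t. set_trm t \<subseteq> Sig \<and> heq (den t) X"
  using assms
proof (induction "card (sv X)" arbitrary: X rule: less_induct)
  case less
  have X: "is_tree X" and lab: "\<And>u a v. (u, a, v) \<in> se X \<Longrightarrow> a \<in> Sig"
    using less.prems by (auto simp: is_Sigma_tree_def)
  \<comment> \<open>Stated for other distinguished vertices on the graph of \<open>X\<close>, since
    it is applied to \<open>X\<close> with one of them moved; the induction measure is unaffected by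
    that.\<close>
  have split: "\<exists>t. set_trm t \<subseteq> Sig \<and> heq (den t) Y"
    if Y: "is_tree Y" "sv Y = sv X" "se Y = se X" "ss Y \<noteq> st Y" for Y
  proof -
    have "(ss Y, st Y) \<in> (darc (se Y))\<^sup>*" using Y by (simp add: is_tree_gtree)
    then obtain w where "(ss Y, w) \<in> darc (se Y)" "(w, st Y) \<in> (darc (se Y))\<^sup>*"
      using Y(4) by (meson converse_rtranclE)
    then obtain a where e: "(ss Y, a, w) \<in> se Y" "(w, st Y) \<in> (darc (se Y))\<^sup>*"
      by (auto simp: darc_def)
    obtain C D where CD: "is_tree C" "is_tree D" "card (sv C) < card (sv X)" "card (sv D) < card (sv X)"
      "se C \<subseteq> se X" "se D \<subseteq> se X" "heq (tprod_u (tprod_u C (base_tree a)) D) Y"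
      by (rule tree_split[OF Y(1) e]) (simp only: Y that)
    then have "is_Sigma_tree Sig C" "is_Sigma_tree Sig D" using lab by (auto simp: is_Sigma_tree_def)
    then obtain s t where "set_trm s \<subseteq> Sig" "heq (den s) C" "set_trm t \<subseteq> Sig" "heq (den t) D"
      using less.hyps CD by meson
    then have "set_trm (Mul (Mul s (Gen a)) t) \<subseteq> Sig" "heq (den (Mul (Mul s (Gen a)) t)) Y"
      using heq_trans[OF heq_prod[OF heq_prod[OF _ heq_refl]] CD(7)] lab e Y by auto
    then show ?thesis by blast
  qed
  show ?case
  proof (cases "se X = {}")
    case True
    then have "set_trm One \<subseteq> Sig" "heq (den One) X"
      using edgeless_heq_trivial[OF X] by simp_all
    then show ?thesis by blast
  next
    case False
    show ?thesis
    proof (cases "ss X = st X")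
      case eq: True
      have T: "gtree (sv X) (se X)" and s: "ss X \<in> sv X" using X by (auto simp: is_tree_gtree)
      have "2 \<le> card (sv X)" using False edges_nonempty_iff[OF X] by simp
      then obtain v where v: "v \<in> sv X" "v \<noteq> ss X"
        by (metis One_nat_def card.empty card_insert_le_m1 insertCI not_less_eq_eq numeral_2_eq_2 subsetI subset_singleton_iff
            card_1_singleton_iff le_zero_eq zero_neq_numeral)
      then have "(ss X, v) \<in> (uarc (se X))\<^sup>*" using T s by (simp add: gtree_def)
      then obtain w where "(ss X, w) \<in> uarc (se X)" using v by (metis converse_rtranclE)
      then obtain a where "(ss X, a, w) \<in> se X \<or> (w, a, ss X) \<in> se X" by (auto elim!: uarcE)
      then show ?thesis
      proof
        assume e: "(ss X, a, w) \<in> se X"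
        let ?Y = "X\<lparr>st := w\<rparr>"
        have "is_tree ?Y" using X e tree_edge_in[OF X e] by (auto simp: is_tree_gtree intro: darcI)
        moreover have "ss X \<noteq> w" using gtree_acyclic[OF T e] by auto
        ultimately obtain t where t: "set_trm t \<subseteq> Sig" "heq (den t) ?Y" using split[of ?Y] by auto
        have "tplus_u ?Y = X" using eq by (simp add: tplus_u_def)
        then have "heq (den (Plus t)) X" using heq_plus[OF t(2)] by simp
        then show ?thesis using t(1) by (intro exI[of _ "Plus t"]) simp
      next
        assume e: "(w, a, ss X) \<in> se X"
        let ?Y = "X\<lparr>ss := w\<rparr>"
        have "is_tree ?Y" using X e eq tree_edge_in[OF X e] by (auto simp: is_tree_gtree intro: darcI)
        moreover have "ss X \<noteq> w" using gtree_acyclic[OF T e] by auto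
        ultimately obtain t where t: "set_trm t \<subseteq> Sig" "heq (den t) ?Y" using split[of ?Y] eq by auto
        have "tstar_u ?Y = X" using eq by (simp add: tstar_u_def)
        then have "heq (den (Star t)) X" using heq_star[OF t(2)] by simp
        then show ?thesis using t(1) by (intro exI[of _ "Star t"]) simp
      qed
    qed (use split X in blast)
  qed
qed

section \<open>Adequate monoids described by equations, and their semilattice of projections\<close>

locale adequate_monoid =
  fixes M :: "'m set" and mul :: "'m \<Rightarrow> 'm \<Rightarrow> 'm" (infixl "\<odot>" 70) and one :: 'm
    and pl sr :: "'m \<Rightarrow> 'm"
  assumes one_in [simp]: "one \<in> M"
    and mul_in [simp]: "x \<in> M \<Longrightarrow> y \<in> M \<Longrightarrow> x \<odot> y \<in> M"
    and pl_in [simp]: "x \<in> M \<Longrightarrow> pl x \<in> M"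
    and sr_in [simp]: "x \<in> M \<Longrightarrow> sr x \<in> M"
    and mul_assoc: "x \<in> M \<Longrightarrow> y \<in> M \<Longrightarrow> z \<in> M \<Longrightarrow> x \<odot> y \<odot> z = x \<odot> (y \<odot> z)"
    and one_mul [simp]: "x \<in> M \<Longrightarrow> one \<odot> x = x"
    and mul_one [simp]: "x \<in> M \<Longrightarrow> x \<odot> one = x"
    and pl_mul: "x \<in> M \<Longrightarrow> pl x \<odot> x = x"
    and mul_sr: "x \<in> M \<Longrightarrow> x \<odot> sr x = x"
    and pl_mul_pl: "x \<in> M \<Longrightarrow> y \<in> M \<Longrightarrow> pl (x \<odot> pl y) = pl (x \<odot> y)"
    and sr_sr_mul: "x \<in> M \<Longrightarrow> y \<in> M \<Longrightarrow> sr (sr x \<odot> y) = sr (x \<odot> y)"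
    and pl_pl_mul: "x \<in> M \<Longrightarrow> y \<in> M \<Longrightarrow> pl (pl x \<odot> y) = pl x \<odot> pl y"
    and sr_mul_sr: "x \<in> M \<Longrightarrow> y \<in> M \<Longrightarrow> sr (x \<odot> sr y) = sr x \<odot> sr y"
    and pl_commute: "x \<in> M \<Longrightarrow> y \<in> M \<Longrightarrow> pl x \<odot> pl y = pl y \<odot> pl x"
    and pl_sr [simp]: "x \<in> M \<Longrightarrow> pl (sr x) = sr x"
    and sr_pl [simp]: "x \<in> M \<Longrightarrow> sr (pl x) = pl x"
begin

definition I :: "'m set" where
  "I = {e \<in> M. pl e = e}"

text \<open>On \<open>I\<close> this is the natural order of a semilattice, in which products are
  meets.\<close>

definition below :: "'m \<Rightarrow> 'm \<Rightarrow> bool" where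
  "below e f \<longleftrightarrow> e \<odot> f = e"

lemma dual: "adequate_monoid M (\<lambda>x y. y \<odot> x) one sr pl"
proof
  fix x y assume "x \<in> M" "y \<in> M"
  then show "sr y \<odot> sr x = sr x \<odot> sr y"
    using pl_commute[of "sr x" "sr y"] by simp
qed (simp_all add: mul_assoc pl_mul mul_sr pl_mul_pl sr_sr_mul pl_pl_mul sr_mul_sr)

lemma I_in [simp]: "e \<in> I \<Longrightarrow> e \<in> M"
  unfolding I_def by simp

lemma pl_I [simp]: "e \<in> I \<Longrightarrow> pl e = e"
  unfolding I_def by simp

lemma sr_I [simp]: "e \<in> I \<Longrightarrow> sr e = e"
  using sr_pl[of e] unfolding I_def by simp

lemma pl_pl [simp]: "x \<in> M \<Longrightarrow> pl (pl x) = pl x"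
  using pl_mul_pl[of one x] by simp

lemma pl_in_I [simp]: "x \<in> M \<Longrightarrow> pl x \<in> I"
  and sr_in_I [simp]: "x \<in> M \<Longrightarrow> sr x \<in> I"
  unfolding I_def by simp_all

lemma one_in_I [simp]: "one \<in> I"
  using pl_mul[of one] unfolding I_def by simp

lemma I_idem [simp]: "e \<in> I \<Longrightarrow> e \<odot> e = e"
  using pl_mul[of e] by simp

lemma I_commute: "e \<in> I \<Longrightarrow> f \<in> I \<Longrightarrow> e \<odot> f = f \<odot> e"
  using pl_commute[of e f] by simp

lemma pl_I_mul: "e \<in> I \<Longrightarrow> x \<in> M \<Longrightarrow> pl (e \<odot> x) = e \<odot> pl x"
  using pl_pl_mul[of e x] by simp

lemma sr_mul_I: "e \<in> I \<Longrightarrow> x \<in> M \<Longrightarrow> sr (x \<odot> e) = sr x \<odot> e"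
  using sr_mul_sr[of x e] by simp

lemma I_mul_in [simp]: "e \<in> I \<Longrightarrow> f \<in> I \<Longrightarrow> e \<odot> f \<in> I"
  using pl_I_mul[of e f] unfolding I_def by simp

lemma I_left_commute: "e \<in> I \<Longrightarrow> f \<in> I \<Longrightarrow> x \<in> M \<Longrightarrow> e \<odot> (f \<odot> x) = f \<odot> (e \<odot> x)"
  using I_commute[of e f] by (simp flip: mul_assoc)

lemma I_left_idem: "e \<in> I \<Longrightarrow> x \<in> M \<Longrightarrow> e \<odot> (e \<odot> x) = e \<odot> x"
  by (simp flip: mul_assoc)

lemma below_antisym: "e \<in> I \<Longrightarrow> f \<in> I \<Longrightarrow> below e f \<Longrightarrow> below f e \<Longrightarrow> e = f"
  unfolding below_def using I_commute by metis

lemma below_trans: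
  assumes "e \<in> I" "f \<in> I" "g \<in> I" "below e f" "below f g"
  shows "below e g"
  using assms mul_assoc[of e f g] unfolding below_def by simp

lemma below_mulI: "e \<in> I \<Longrightarrow> f \<in> I \<Longrightarrow> g \<in> I \<Longrightarrow> below e f \<Longrightarrow> below e g \<Longrightarrow> below e (f \<odot> g)"
  unfolding below_def by (simp flip: mul_assoc)

lemma below_one: "e \<in> I \<Longrightarrow> below e one"
  by (simp add: below_def)

text \<open>\<open>x \<odot> e = x \<odot> f \<odot> e\<close>, so \<open>pl (x \<odot> f)\<close>
  acts as a left identity on \<open>x \<odot> e\<close>.\<close>

lemma below_pl_mul_mono:
  assumes "x \<in> M" "e \<in> I" "f \<in> I" "below e f"
  shows "below (pl (x \<odot> e)) (pl (x \<odot> f))"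
proof -
  have "x \<odot> e = x \<odot> f \<odot> e"
    using assms I_commute[of e f] by (simp add: mul_assoc below_def)
  then have "pl (x \<odot> e) = pl (pl (x \<odot> f) \<odot> (x \<odot> e))"
    using assms pl_mul[of "x \<odot> f"] mul_assoc[of "pl (x \<odot> f)" "x \<odot> f" e] by simp
  also have "\<dots> = pl (x \<odot> e) \<odot> pl (x \<odot> f)"
    using assms pl_commute[of "x \<odot> e" "x \<odot> f"] by (simp add: pl_pl_mul)
  finally show ?thesis by (simp add: below_def)
qed

text \<open>For one edge with value \<open>x\<close> and bounds \<open>L\<close>, \<open>R\<close>
  at its ends, the labels will be \<open>L \<odot> pl (x \<odot> R)\<close> and
  \<open>sr (L \<odot> x) \<odot> R\<close>. This is one of the two edge conditions, the other being
  its dual; it holds because \<open>L \<odot> x\<close> absorbs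
  \<open>sr (L \<odot> x)\<close>.\<close>

lemma edge_below:
  assumes "L \<in> I" "R \<in> I" "x \<in> M"
  shows "below (L \<odot> pl (x \<odot> R)) (pl (x \<odot> (sr (L \<odot> x) \<odot> R)))"
proof -
  let ?q = "pl (x \<odot> (sr (L \<odot> x) \<odot> R))"
  have "L \<odot> (x \<odot> R) = L \<odot> (x \<odot> (sr (L \<odot> x) \<odot> R))"
    using assms mul_sr[of "L \<odot> x"] by (simp flip: mul_assoc)
  then have eq: "L \<odot> pl (x \<odot> R) = L \<odot> ?q"
    using assms by (simp flip: pl_I_mul)
  have "L \<odot> ?q \<odot> ?q = L \<odot> ?q" using assms by (simp add: mul_assoc)
  then show ?thesis by (simp add: below_def eq)
qed

text \<open>The corrections \<open>pl (x \<odot> R)\<close> and \<open>sr (L \<odot> x)\<close> are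
  absorbed by \<open>x \<odot> R\<close> and \<open>L \<odot> x\<close>, so the product along a
  maximally labelled edge sees only the bounds.\<close>

lemma edge_product:
  assumes "L \<in> I" "R \<in> I" "x \<in> M"
  shows "L \<odot> pl (x \<odot> R) \<odot> x \<odot> (sr (L \<odot> x) \<odot> R) = L \<odot> x \<odot> R"
proof -
  have "L \<odot> pl (x \<odot> R) \<odot> x \<odot> (sr (L \<odot> x) \<odot> R) = pl (x \<odot> R) \<odot> ((L \<odot> x) \<odot> sr (L \<odot> x)) \<odot> R"
    using assms by (simp add: mul_assoc I_left_commute[of L])
  also have "\<dots> = L \<odot> (pl (x \<odot> R) \<odot> (x \<odot> R))"
    using assms by (simp add: mul_sr) (simp add: mul_assoc I_left_commute[of L])
  finally show ?thesis using assms by (simp add: pl_mul mul_assoc)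
qed

end

section \<open>Labellings by idempotents\<close>

locale evaluation = adequate_monoid M mul one pl sr
  for M :: "'m set" and mul (infixl "\<odot>" 70) and one pl sr +
  fixes \<chi> :: "'a \<Rightarrow> 'm"
  assumes chi_in [simp]: "\<chi> a \<in> M"
begin

primrec ev :: "'a trm \<Rightarrow> 'm" where
  "ev One = one"
| "ev (Gen a) = \<chi> a"
| "ev (Mul s t) = ev s \<odot> ev t"
| "ev (Plus t) = pl (ev t)"
| "ev (Star t) = sr (ev t)"

lemma ev_in [simp]: "ev t \<in> M"
  by (induction t) auto

text \<open>Think of \<open>\<sigma> v\<close> as an idempotent below the value of the tree with both distinguished vertices
  moved to \<open>v\<close>.\<close>
definition valid :: "'a stree \<Rightarrow> (nat \<Rightarrow> 'm) \<Rightarrow> bool" where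
  "valid X \<sigma> \<longleftrightarrow> (\<forall>v. \<sigma> v \<in> I) \<and>
     (\<forall>(u, a, w) \<in> se X. below (\<sigma> u) (pl (\<chi> a \<odot> \<sigma> w)) \<and> below (\<sigma> w) (sr (\<sigma> u \<odot> \<chi> a)))"

text \<open>The target \<open>v\<close> is a fixed parameter and edges are prepended, so
  \<open>z\<close> is the alternating product of labels and letters along a path from
  \<open>u\<close> to \<open>v\<close>. A relation avoids computing paths; in a tree it is
  functional by \<open>trunk_det\<close>.\<close>

inductive trunk :: "(nat \<times> 'a \<times> nat) set \<Rightarrow> (nat \<Rightarrow> 'm) \<Rightarrow> nat \<Rightarrow> nat \<Rightarrow> 'm \<Rightarrow> bool" for E \<sigma> v where
  base: "trunk E \<sigma> v v (\<sigma> v)"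
| step: "(u, a, w) \<in> E \<Longrightarrow> trunk E \<sigma> v w z \<Longrightarrow> trunk E \<sigma> v u (\<sigma> u \<odot> \<chi> a \<odot> z)"

lemma valid_I: "valid X \<sigma> \<Longrightarrow> \<sigma> v \<in> I"
  by (simp add: valid_def)

lemma valid_edge:
  assumes "valid X \<sigma>" "(u, a, w) \<in> se X"
  shows "\<sigma> u \<odot> pl (\<chi> a \<odot> \<sigma> w) = \<sigma> u" "\<sigma> w \<odot> sr (\<sigma> u \<odot> \<chi> a) = \<sigma> w"
  using assms unfolding valid_def below_def by blast+

lemma valid_pullback: "valid Y \<sigma> \<Longrightarrow> ehom X Y f \<Longrightarrow> valid X (\<sigma> \<circ> f)"
  unfolding valid_def ehom_def by fastforce

lemma trunk_path: "trunk E \<sigma> v u z \<Longrightarrow> (u, v) \<in> (darc E)\<^sup>*"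
  by (induction rule: trunk.induct) (auto intro: converse_rtrancl_into_rtrancl darcI)

lemma trunk_det:
  assumes T: "gtree V E" and "trunk E \<sigma> v u z" "trunk E \<sigma> v u z'"
  shows "z = z'"
  using assms(2,3)
proof (induction arbitrary: z' rule: trunk.induct)
  case base
  then show ?case
    by cases (use trunk_path gtree_acyclic[OF T] in \<open>blast+\<close>)
next
  case (step u a w z)
  from step.prems show ?case
  proof cases
    case base
    then show ?thesis using trunk_path[OF step.hyps(2)] gtree_acyclic[OF T step.hyps(1)] by auto
  next
    case (step b w' y)
    then have "a = b \<and> w = w'"
      using gtree_first_edge_unique[OF T] trunk_path \<open>(u, a, w) \<in> E\<close> \<open>trunk E \<sigma> v w z\<close> by blast
    then show ?thesis using step \<open>\<And>z'. trunk E \<sigma> v w z' \<Longrightarrow> z = z'\<close> by auto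
  qed
qed

text \<open>Agreement of labels is demanded only along the path: in \<open>ev_heq\<close> the two
  labellings are merely comparable elsewhere.\<close>

lemma trunk_map:
  assumes "trunk (se X) \<sigma> v u z" "ehom X Y f"
    and "\<And>w. (u, w) \<in> (darc (se X))\<^sup>* \<Longrightarrow> (w, v) \<in> (darc (se X))\<^sup>* \<Longrightarrow> \<sigma>' (f w) = \<sigma> w"
  shows "trunk (se Y) \<sigma>' (f v) (f u) z"
  using assms(1,3)
proof (induction rule: trunk.induct)
  case base
  then show ?case using trunk.base[of "se Y" \<sigma>' "f v"] by simp
next
  case (step u a w z)
  have uw: "(u, w) \<in> (darc (se X))\<^sup>*" using step.hyps(1) by (auto intro: darcI)
  then have wv: "(w, v) \<in> (darc (se X))\<^sup>*" "(u, v) \<in> (darc (se X))\<^sup>*"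
    using trunk_path[OF step.hyps(2)] by auto
  have "trunk (se Y) \<sigma>' (f v) (f w) z"
    using step.IH step.prems uw by (meson rtrancl_trans)
  moreover have "(f u, a, f w) \<in> se Y" using assms(2) step.hyps(1) by (auto simp: ehom_def)
  moreover have "\<sigma>' (f u) = \<sigma> u" using step.prems wv by simp
  ultimately show ?case using trunk.step[of "f u" a "f w" "se Y" \<sigma>'] by simp
qed

lemma trunk_in: "trunk E \<sigma> v u z \<Longrightarrow> (\<And>v. \<sigma> v \<in> I) \<Longrightarrow> z \<in> M"
  by (induction rule: trunk.induct) auto

lemma trunk_absorb: "trunk E \<sigma> v u z \<Longrightarrow> (\<And>v. \<sigma> v \<in> I) \<Longrightarrow> \<sigma> u \<odot> z = z"
  by (induction rule: trunk.induct) (auto simp: trunk_in mul_assoc I_left_idem)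

text \<open>The label of the joining vertex \<open>m\<close> ends \<open>z\<close> and begins
  \<open>y\<close>; being idempotent, it is absorbed.\<close>

lemma trunk_append:
  assumes "trunk E \<sigma> m u z" "trunk E \<sigma> v m y" and s: "\<And>v. \<sigma> v \<in> I"
  shows "trunk E \<sigma> v u (z \<odot> y)"
  using assms(1)
proof (induction rule: trunk.induct)
  case base
  then show ?case using assms trunk_absorb by simp
next
  case (step u a w z)
  have "z \<in> M" "y \<in> M" using step.hyps(2) assms(2) s trunk_in by blast+
  then show ?case using trunk.step[OF step.hyps(1) step.IH] s by (simp add: mul_assoc)
qed

text \<open>The product collapses from its far end, each step by the edge condition \<open>\<sigma>
  u \<odot> pl (\<chi> a \<odot> \<sigma> w) = \<sigma> u\<close>. Thus the value of a trunk
  determines the labels at its ends, which is how labellings of two factors are matched.\<close>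

lemma trunk_pl:
  assumes "trunk (se X) \<sigma> v u z" "valid X \<sigma>"
  shows "pl z = \<sigma> u"
  using assms(1)
proof (induction rule: trunk.induct)
  case base
  then show ?case using valid_I[OF assms(2)] by simp
next
  case (step u a w z)
  have s: "\<And>v. \<sigma> v \<in> I" and z: "z \<in> M" using valid_I[OF assms(2)] trunk_in[OF step.hyps(2)] by auto
  have "pl (\<sigma> u \<odot> \<chi> a \<odot> z) = pl (\<sigma> u \<odot> \<chi> a \<odot> pl z)" using s z by (simp add: pl_mul_pl)
  also have "\<dots> = \<sigma> u \<odot> pl (\<chi> a \<odot> \<sigma> w)" using s step.IH by (simp add: mul_assoc pl_I_mul)
  finally show ?case using valid_edge[OF assms(2) step.hyps(1)] by simp
qed

text \<open>Not literally dual, because paths grow at the front: the prefix enters through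
  \<open>sr (\<sigma> u \<odot> \<chi> a)\<close>, which lies above \<open>\<sigma> w\<close> and is
  therefore absorbed by \<open>z\<close>.\<close>

lemma trunk_sr:
  assumes "trunk (se X) \<sigma> v u z" "valid X \<sigma>"
  shows "sr z = \<sigma> v"
  using assms(1)
proof (induction rule: trunk.induct)
  case base
  then show ?case using valid_I[OF assms(2)] by simp
next
  case (step u a w z)
  have s: "\<And>v. \<sigma> v \<in> I" and z: "z \<in> M" using valid_I[OF assms(2)] trunk_in[OF step.hyps(2)] by auto
  let ?e = "sr (\<sigma> u \<odot> \<chi> a)"
  have e: "?e \<in> I" using s by simp
  have "?e \<odot> z = ?e \<odot> \<sigma> w \<odot> z" using trunk_absorb[OF step.hyps(2)] s z e by (simp add: mul_assoc)
  also have "?e \<odot> \<sigma> w = \<sigma> w"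
    using valid_edge[OF assms(2) step.hyps(1)] I_commute[OF e s] by simp
  finally have "?e \<odot> z = z" using trunk_absorb[OF step.hyps(2)] s by simp
  then show ?case using sr_sr_mul[of "\<sigma> u \<odot> \<chi> a" z] s z step.IH by simp
qed

text \<open>The bounds \<open>L\<close> and \<open>R\<close> stand for idempotents hung at the start and end vertex; they make the
  induction on \<open>t\<close> go through, the case needed later being \<open>L = R = one\<close>.\<close>
lemma max_labelling:
  assumes "L \<in> I" "R \<in> I"
  obtains \<sigma> where "valid (den t) \<sigma>" "trunk (se (den t)) \<sigma> (st (den t)) (ss (den t)) (L \<odot> ev t \<odot> R)"
    "\<And>\<tau> v. valid (den t) \<tau> \<Longrightarrow> below (\<tau> (ss (den t))) L \<Longrightarrow> below (\<tau> (st (den t))) R \<Longrightarrow>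
       v \<in> sv (den t) \<Longrightarrow> below (\<tau> v) (\<sigma> v)"
  using assms
proof (induction t arbitrary: L R thesis)
  case One
  note LR = One.prems(2,3)
  show ?case
  proof (rule One.prems(1)[of "\<lambda>_. L \<odot> R"])
    show "valid (den One) (\<lambda>_. L \<odot> R)" using LR by (simp add: valid_def)
    show "trunk (se (den One)) (\<lambda>_. L \<odot> R) (st (den One)) (ss (den One)) (L \<odot> ev One \<odot> R)"
      using LR trunk.base[of "se (den One)" "\<lambda>_. L \<odot> R"] by simp
  next
    fix \<tau> v assume "valid (den One) \<tau>" "below (\<tau> (ss (den One))) L" "below (\<tau> (st (den One))) R"
      "v \<in> sv (den One)"
    then show "below (\<tau> v) (L \<odot> R)" using LR valid_I by (auto intro: below_mulI)
  qed
next
  case (Gen a)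
  let ?x = "\<chi> a"
  \<comment> \<open>A valid labelling within the bounds has its start label below \<open>L\<close>
    and below \<open>pl (?x \<odot> R)\<close>, and dually at the end; these products are the
    meets.\<close>
  let ?s = "\<lambda>v::nat. if v = 0 then L \<odot> pl (?x \<odot> R) else sr (L \<odot> ?x) \<odot> R"
  note LR = Gen.prems(2,3)
  interpret dual: adequate_monoid M "\<lambda>x y. y \<odot> x" one sr pl by (rule dual)
  have dI: "dual.I = I" unfolding dual.I_def I_def using sr_pl pl_sr by metis
  show ?case
  proof (rule Gen.prems(1)[of ?s])
    have 1: "below (L \<odot> pl (?x \<odot> R)) (pl (?x \<odot> (sr (L \<odot> ?x) \<odot> R)))"
      using LR by (simp add: edge_below)
    have 2: "below (sr (L \<odot> ?x) \<odot> R) (sr (L \<odot> pl (?x \<odot> R) \<odot> ?x))"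
    proof -
      have "sr (L \<odot> pl (?x \<odot> R) \<odot> ?x) \<odot> (sr (L \<odot> ?x) \<odot> R) = sr (L \<odot> ?x) \<odot> R"
        using dual.edge_below[of R L ?x] LR by (simp add: dI dual.below_def)
      then show ?thesis
        using LR I_commute[of "sr (L \<odot> ?x) \<odot> R" "sr (L \<odot> pl (?x \<odot> R) \<odot> ?x)"] by (simp add: below_def)
    qed
    show "valid (den (Gen a)) ?s" using LR 1 2 by (simp add: valid_def)
    have "trunk {(0, a, 1)} ?s 1 0 (?s 0 \<odot> ?x \<odot> ?s 1)" by (intro trunk.step[OF _ trunk.base]) simp
    then show "trunk (se (den (Gen a))) ?s (st (den (Gen a))) (ss (den (Gen a))) (L \<odot> ev (Gen a) \<odot> R)"
      using LR by (simp add: edge_product)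
  next
    fix \<tau> v assume t: "valid (den (Gen a)) \<tau>" "below (\<tau> (ss (den (Gen a)))) L"
      "below (\<tau> (st (den (Gen a)))) R" "v \<in> sv (den (Gen a))"
    have tI: "\<And>v. \<tau> v \<in> I" by (rule valid_I[OF t(1)])
    have e: "below (\<tau> 0) (pl (?x \<odot> \<tau> 1))" "below (\<tau> 1) (sr (\<tau> 0 \<odot> ?x))"
      using t(1) by (simp_all add: valid_def)
    have "below (\<tau> 0) (pl (?x \<odot> R))"
      by (rule below_trans[OF _ _ _ e(1)]) (use t tI LR in \<open>simp_all add: below_pl_mul_mono\<close>)
    moreover have "below (\<tau> 1) (sr (L \<odot> ?x))"
    proof (rule below_trans[OF _ _ _ e(2)])
      have "dual.below (\<tau> 0) L"
        using t(2) I_commute[OF tI LR(1)] by (simp add: below_def dual.below_def)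
      then have "dual.below (sr (\<tau> 0 \<odot> ?x)) (sr (L \<odot> ?x))"
        using dual.below_pl_mul_mono[of ?x "\<tau> 0" L] tI LR by (simp add: dI)
      then show "below (sr (\<tau> 0 \<odot> ?x)) (sr (L \<odot> ?x))"
        using I_commute[of "sr (\<tau> 0 \<odot> ?x)" "sr (L \<odot> ?x)"] tI LR by (simp add: below_def dual.below_def)
    qed (use tI LR in simp_all)
    ultimately show "below (\<tau> v) (?s v)" using t tI LR by (auto intro!: below_mulI)
  qed
next
  case (Mul s t)
  note LR = Mul.prems(2,3)
  \<comment> \<open>The constraints that the right and the left factor, each taken alone, impose on
    the gluing vertex. Each serves as a bound for the other factor.\<close>
  let ?p = "pl (ev t \<odot> R)" and ?q = "sr (L \<odot> ev s)"
  let ?r = "glue_right (den s) (den t)"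
  have pq: "?p \<in> I" "?q \<in> I" using LR by simp_all
  obtain \<sigma>1 where s1: "valid (den s) \<sigma>1"
    "trunk (se (den s)) \<sigma>1 (st (den s)) (ss (den s)) (L \<odot> ev s \<odot> ?p)"
    "\<And>\<tau> v. valid (den s) \<tau> \<Longrightarrow> below (\<tau> (ss (den s))) L \<Longrightarrow> below (\<tau> (st (den s))) ?p \<Longrightarrow>
       v \<in> sv (den s) \<Longrightarrow> below (\<tau> v) (\<sigma>1 v)"
    by (rule Mul.IH(1)[OF _ LR(1) pq(1)]) (rule that)
  obtain \<sigma>2 where s2: "valid (den t) \<sigma>2"
    "trunk (se (den t)) \<sigma>2 (st (den t)) (ss (den t)) (?q \<odot> ev t \<odot> R)"
    "\<And>\<tau> v. valid (den t) \<tau> \<Longrightarrow> below (\<tau> (ss (den t))) ?q \<Longrightarrow> below (\<tau> (st (den t))) R \<Longrightarrow>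
       v \<in> sv (den t) \<Longrightarrow> below (\<tau> v) (\<sigma>2 v)"
    by (rule Mul.IH(2)[OF _ pq(2) LR(2)]) (rule that)
  \<comment> \<open>\<open>\<sigma>3\<close> and \<open>\<sigma>4\<close> leave the gluing vertex
    unbounded. They show that every competing labelling obeys \<open>?q\<close> and
    \<open>?p\<close> there, so that maximality of \<open>\<sigma>1\<close> and
    \<open>\<sigma>2\<close> applies to it.\<close>
  obtain \<sigma>3 where s3: "valid (den s) \<sigma>3"
    "trunk (se (den s)) \<sigma>3 (st (den s)) (ss (den s)) (L \<odot> ev s \<odot> one)"
    "\<And>\<tau> v. valid (den s) \<tau> \<Longrightarrow> below (\<tau> (ss (den s))) L \<Longrightarrow> below (\<tau> (st (den s))) one \<Longrightarrow>
       v \<in> sv (den s) \<Longrightarrow> below (\<tau> v) (\<sigma>3 v)"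
    by (rule Mul.IH(1)[OF _ LR(1) one_in_I]) (rule that)
  obtain \<sigma>4 where s4: "valid (den t) \<sigma>4"
    "trunk (se (den t)) \<sigma>4 (st (den t)) (ss (den t)) (one \<odot> ev t \<odot> R)"
    "\<And>\<tau> v. valid (den t) \<tau> \<Longrightarrow> below (\<tau> (ss (den t))) one \<Longrightarrow> below (\<tau> (st (den t))) R \<Longrightarrow>
       v \<in> sv (den t) \<Longrightarrow> below (\<tau> v) (\<sigma>4 v)"
    by (rule Mul.IH(2)[OF _ one_in_I LR(2)]) (rule that)
  have i1: "\<And>v. \<sigma>1 v \<in> I" and i2: "\<And>v. \<sigma>2 v \<in> I" using valid_I[OF s1(1)] valid_I[OF s2(1)] by simp_all
  \<comment> \<open>Both factors see the meet of the two constraints at the gluing vertex, so their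
    labellings can be glued.\<close>
  have "\<sigma>1 (st (den s)) = ?q \<odot> ?p"
    using trunk_sr[OF s1(2,1)] LR by (simp add: sr_mul_I)
  moreover have "\<sigma>2 (ss (den t)) = ?q \<odot> ?p"
    using trunk_pl[OF s2(2,1)] LR by (simp add: mul_assoc pl_I_mul)
  ultimately have glue: "\<sigma>1 (st (den s)) = \<sigma>2 (ss (den t))" by simp
  let ?\<sigma> = "tcopair \<sigma>1 \<sigma>2"
  have sI: "\<And>v. ?\<sigma> v \<in> I" using i1 i2 by (simp add: tcopair_def)
  show ?case
  proof (rule Mul.prems(1)[of ?\<sigma>])
    show "valid (den (Mul s t)) ?\<sigma>"
      using s1(1) s2(1) sI glue by (auto simp: valid_def)
    have "trunk (se (den (Mul s t))) ?\<sigma> (2 * st (den s)) (2 * ss (den s)) (L \<odot> ev s \<odot> ?p)"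
      using trunk_map[OF s1(2) ehom_left, of ?\<sigma>] by simp
    moreover have "trunk (se (den (Mul s t))) ?\<sigma> (?r (st (den t))) (?r (ss (den t))) (?q \<odot> ev t \<odot> R)"
      using trunk_map[OF s2(2) ehom_right, of ?\<sigma>] glue by simp
    ultimately have "trunk (se (den (Mul s t))) ?\<sigma> (?r (st (den t))) (2 * ss (den s))
        ((L \<odot> ev s \<odot> ?p) \<odot> (?q \<odot> ev t \<odot> R))"
      using trunk_append sI by simp
    moreover have "(L \<odot> ev s \<odot> ?p) \<odot> (?q \<odot> ev t \<odot> R) = L \<odot> (ev s \<odot> ev t) \<odot> R"
    proof -
      \<comment> \<open>Once exchanged, \<open>?q\<close> is absorbed by
        \<open>L \<odot> ev s\<close> and \<open>?p\<close> by
        \<open>ev t \<odot> R\<close>.\<close>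
      have "(L \<odot> ev s \<odot> ?p) \<odot> (?q \<odot> ev t \<odot> R) = (L \<odot> ev s \<odot> ?q) \<odot> (?p \<odot> (ev t \<odot> R))"
        using LR pq by (simp add: mul_assoc I_left_commute[of ?p])
      then show ?thesis using LR by (simp add: mul_sr pl_mul) (simp add: mul_assoc)
    qed
    ultimately show "trunk (se (den (Mul s t))) ?\<sigma> (st (den (Mul s t))) (ss (den (Mul s t)))
        (L \<odot> ev (Mul s t) \<odot> R)" by simp
  next
    fix \<tau> v assume t: "valid (den (Mul s t)) \<tau>" "below (\<tau> (ss (den (Mul s t)))) L"
      "below (\<tau> (st (den (Mul s t)))) R" "v \<in> sv (den (Mul s t))"
    have v1: "valid (den s) (\<tau> \<circ> (\<lambda>v. 2 * v))" and v2: "valid (den t) (\<tau> \<circ> ?r)"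
      using valid_pullback[OF t(1)[unfolded den.simps]] ehom_left ehom_right by blast+
    have "below ((\<tau> \<circ> (\<lambda>v. 2 * v)) (st (den s))) (\<sigma>3 (st (den s)))"
      by (rule s3(3)[OF v1]) (use t valid_I[OF t(1)] in \<open>simp_all add: below_one tree_ends_in is_tree_den\<close>)
    moreover have "\<sigma>3 (st (den s)) = ?q" using trunk_sr[OF s3(2,1)] LR by simp
    ultimately have m1: "below (\<tau> (2 * st (den s))) ?q" by simp
    have "below ((\<tau> \<circ> ?r) (ss (den t))) (\<sigma>4 (ss (den t)))"
      by (rule s4(3)[OF v2]) (use t valid_I[OF t(1)] in \<open>simp_all add: below_one tree_ends_in is_tree_den\<close>)
    moreover have "\<sigma>4 (ss (den t)) = ?p" using trunk_pl[OF s4(2,1)] LR by simp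
    ultimately have m2: "below (\<tau> (2 * st (den s))) ?p" by simp
    have "below ((\<tau> \<circ> (\<lambda>v. 2 * v)) u) (\<sigma>1 u)" if "u \<in> sv (den s)" for u
      by (rule s1(3)[OF v1]) (use t m2 that in simp_all)
    moreover have "below ((\<tau> \<circ> ?r) u) (\<sigma>2 u)" if "u \<in> sv (den t)" for u
      by (rule s2(3)[OF v2]) (use t m1 that in simp_all)
    ultimately show "below (\<tau> v) (?\<sigma> v)" using t(4) glue by auto
  qed
next
  case (Plus t)
  note LR = Plus.prems(2,3)
  have LRI: "L \<odot> R \<in> I" using LR by simp
  \<comment> \<open>Start and end coincide in the new tree, so both bounds bear on the start vertex
    of \<open>den t\<close>, whose end vertex is left unbounded.\<close>
  obtain \<sigma> where s: "valid (den t) \<sigma>"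
    "trunk (se (den t)) \<sigma> (st (den t)) (ss (den t)) (L \<odot> R \<odot> ev t \<odot> one)"
    "\<And>\<tau> v. valid (den t) \<tau> \<Longrightarrow> below (\<tau> (ss (den t))) (L \<odot> R) \<Longrightarrow> below (\<tau> (st (den t))) one \<Longrightarrow>
       v \<in> sv (den t) \<Longrightarrow> below (\<tau> v) (\<sigma> v)"
    by (rule Plus.IH[OF _ LRI one_in_I]) (rule that)
  show ?case
  proof (rule Plus.prems(1)[of \<sigma>])
    show "valid (den (Plus t)) \<sigma>" using s(1) by (simp add: valid_def)
    have "\<sigma> (ss (den t)) = L \<odot> pl (ev t) \<odot> R"
      using trunk_pl[OF s(2,1)] LR I_commute[of "pl (ev t)" R] by (simp add: pl_I_mul mul_assoc)
    then show "trunk (se (den (Plus t))) \<sigma> (st (den (Plus t))) (ss (den (Plus t))) (L \<odot> ev (Plus t) \<odot> R)"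
      using trunk.base[of "se (den t)" \<sigma> "ss (den t)"] by simp
  next
    fix \<tau> v assume t: "valid (den (Plus t)) \<tau>" "below (\<tau> (ss (den (Plus t)))) L"
      "below (\<tau> (st (den (Plus t)))) R" "v \<in> sv (den (Plus t))"
    have "valid (den t) \<tau>" using t(1) by (simp add: valid_def)
    then show "below (\<tau> v) (\<sigma> v)"
      by (rule s(3)) (use t LR valid_I[OF t(1)] in \<open>simp_all add: below_mulI below_one\<close>)
  qed
next
  case (Star t)
  note LR = Star.prems(2,3)
  have LRI: "L \<odot> R \<in> I" using LR by simp
  obtain \<sigma> where s: "valid (den t) \<sigma>"
    "trunk (se (den t)) \<sigma> (st (den t)) (ss (den t)) (one \<odot> ev t \<odot> (L \<odot> R))"
    "\<And>\<tau> v. valid (den t) \<tau> \<Longrightarrow> below (\<tau> (ss (den t))) one \<Longrightarrow> below (\<tau> (st (den t))) (L \<odot> R) \<Longrightarrow>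
       v \<in> sv (den t) \<Longrightarrow> below (\<tau> v) (\<sigma> v)"
    by (rule Star.IH[OF _ one_in_I LRI]) (rule that)
  show ?case
  proof (rule Star.prems(1)[of \<sigma>])
    show "valid (den (Star t)) \<sigma>" using s(1) by (simp add: valid_def)
    have "\<sigma> (st (den t)) = L \<odot> sr (ev t) \<odot> R"
      using trunk_sr[OF s(2,1)] LR I_left_commute[of "sr (ev t)" L R] by (simp add: sr_mul_I mul_assoc)
    then show "trunk (se (den (Star t))) \<sigma> (st (den (Star t))) (ss (den (Star t))) (L \<odot> ev (Star t) \<odot> R)"
      using trunk.base[of "se (den t)" \<sigma> "st (den t)"] by simp
  next
    fix \<tau> v assume t: "valid (den (Star t)) \<tau>" "below (\<tau> (ss (den (Star t)))) L"
      "below (\<tau> (st (den (Star t)))) R" "v \<in> sv (den (Star t))"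
    have "valid (den t) \<tau>" using t(1) by (simp add: valid_def)
    then show "below (\<tau> v) (\<sigma> v)"
      by (rule s(3)) (use t LR valid_I[OF t(1)] in \<open>simp_all add: below_mulI below_one\<close>)
  qed
qed

text \<open>Wherever \<open>g \<circ> f\<close> fixes \<open>w\<close>, maximality on both sides
  gives \<open>\<sigma> w = \<sigma> (g (f w))\<close> below \<open>\<tau> (f w)\<close> below
  \<open>\<sigma> w\<close>. This covers the trunk, so its image under \<open>f\<close> carries the
  same product.\<close>

lemma ev_heq:
  assumes "heq (den s) (den t)"
  shows "ev s = ev t"
proof -
  obtain f g where f: "ehom (den s) (den t) f" "f (ss (den s)) = ss (den t)" "f (st (den s)) = st (den t)"
    and g: "ehom (den t) (den s) g" "g (ss (den t)) = ss (den s)" "g (st (den t)) = st (den s)"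
    using assms unfolding heq_def tle_def tree_hom_ehom by blast
  obtain \<sigma> where s: "valid (den s) \<sigma>" "trunk (se (den s)) \<sigma> (st (den s)) (ss (den s)) (one \<odot> ev s \<odot> one)"
    "\<And>\<tau> v. valid (den s) \<tau> \<Longrightarrow> below (\<tau> (ss (den s))) one \<Longrightarrow> below (\<tau> (st (den s))) one \<Longrightarrow>
       v \<in> sv (den s) \<Longrightarrow> below (\<tau> v) (\<sigma> v)"
    by (rule max_labelling[OF one_in_I one_in_I, of s]) (rule that)
  obtain \<tau> where t: "valid (den t) \<tau>" "trunk (se (den t)) \<tau> (st (den t)) (ss (den t)) (one \<odot> ev t \<odot> one)"
    "\<And>\<rho> v. valid (den t) \<rho> \<Longrightarrow> below (\<rho> (ss (den t))) one \<Longrightarrow> below (\<rho> (st (den t))) one \<Longrightarrow>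
       v \<in> sv (den t) \<Longrightarrow> below (\<rho> v) (\<tau> v)"
    by (rule max_labelling[OF one_in_I one_in_I, of t]) (rule that)
  have Ts: "gtree (sv (den s)) (se (den s))" and Tt: "gtree (sv (den t)) (se (den t))"
    using is_tree_den is_tree_gtree by blast+
  have sI: "\<And>v. \<sigma> v \<in> I" and tI: "\<And>v. \<tau> v \<in> I" using valid_I[OF s(1)] valid_I[OF t(1)] by simp_all
  have le1: "below (\<tau> (f v)) (\<sigma> v)" if "v \<in> sv (den s)" for v
    using s(3)[OF valid_pullback[OF t(1) f(1)]] that tI by (simp add: below_one)
  have le2: "below (\<sigma> (g v)) (\<tau> v)" if "v \<in> sv (den t)" for v
    using t(3)[OF valid_pullback[OF s(1) g(1)]] that sI by (simp add: below_one)
  \<comment> \<open>Walking along the trunk, \<open>g (f z)\<close> is again a successor of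
    \<open>y\<close> from which the end vertex can be reached, so it equals
    \<open>z\<close>.\<close>
  have fix_trunk: "w \<in> sv (den s) \<and> g (f w) = w"
    if "(ss (den s), w) \<in> (darc (se (den s)))\<^sup>*" "(w, st (den s)) \<in> (darc (se (den s)))\<^sup>*" for w
    using that
  proof induction
    case base
    then show ?case using f g tree_ends_in[OF is_tree_den] by simp
  next
    case (step y z)
    have gf: "ehom (den s) (den s) (g \<circ> f)" by (rule ehom_comp[OF f(1) g(1)])
    obtain a where e: "(y, a, z) \<in> se (den s)" using step.hyps(2) by (auto simp: darc_def)
    have y: "g (f y) = y" using step by (meson converse_rtrancl_into_rtrancl)
    then have e': "(y, a, g (f z)) \<in> se (den s)" using gf e by (auto simp: ehom_def)
    have "(g (f z), st (den s)) \<in> (darc (se (den s)))\<^sup>*"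
      using ehom_darc[OF gf step.prems] f g by simp
    then have "z = g (f z)" using gtree_first_edge_unique[OF Ts e e' step.prems] by blast
    then show ?case using tree_edge_in[OF is_tree_den e] by simp
  qed
  have "trunk (se (den t)) \<tau> (f (st (den s))) (f (ss (den s))) (one \<odot> ev s \<odot> one)"
  proof (rule trunk_map[OF s(2) f(1)])
    fix w assume "(ss (den s), w) \<in> (darc (se (den s)))\<^sup>*" "(w, st (den s)) \<in> (darc (se (den s)))\<^sup>*"
    then have w: "w \<in> sv (den s)" "g (f w) = w" using fix_trunk by auto
    then have "f w \<in> sv (den t)" using f(1) by (auto simp: ehom_def)
    then show "\<tau> (f w) = \<sigma> w"
      using le1[of w] le2[of "f w"] w below_antisym[OF tI sI] by simp
  qed
  then have "one \<odot> ev s \<odot> one = one \<odot> ev t \<odot> one"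
    using trunk_det[OF Tt] t(2) f by simp
  then show ?thesis by simp
qed

end

section \<open>Freeness\<close>

fun omul :: "('b \<Rightarrow> 'b \<Rightarrow> 'b) \<Rightarrow> 'b option \<Rightarrow> 'b option \<Rightarrow> 'b option" where
  "omul m None y = y"
| "omul m (Some x) None = Some x"
| "omul m (Some x) (Some y) = Some (m x y)"

lemma omul_None [simp]: "omul m x None = x"
  by (cases x) simp_all

context adequate_semigroup
begin

text \<open>The new identity \<open>None\<close> is fixed by both unary operations. It is adjoined
  even if \<open>S\<close> is a monoid, so that it stays distinguishable from the values of
  nontrivial trees.\<close>

lemma adequate_monoid_option:
  "adequate_monoid (insert None (Some ` S)) (omul m) None (map_option (aplus S m)) (map_option (astar S m))"
proof
  fix x y assume xy: "x \<in> insert None (Some ` S)" "y \<in> insert None (Some ` S)"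
  note facts = closed aplus_in astar_in
  show "omul m x y \<in> insert None (Some ` S)" using xy by (auto simp: facts)
  show "map_option (aplus S m) (omul m x (map_option (aplus S m) y)) = map_option (aplus S m) (omul m x y)"
    using xy by (auto simp: facts aplus_mult aplus_idem aplus_props)
  show "map_option (astar S m) (omul m (map_option (astar S m) x) y) = map_option (astar S m) (omul m x y)"
    using xy by (auto simp: facts astar_mult astar_idem astar_props)
  show "map_option (aplus S m) (omul m (map_option (aplus S m) x) y) =
      omul m (map_option (aplus S m) x) (map_option (aplus S m) y)"
    using xy by (auto simp: facts aplus_idem_mult aplus_idem aplus_props)
  show "map_option (astar S m) (omul m x (map_option (astar S m) y)) =
      omul m (map_option (astar S m) x) (map_option (astar S m) y)"
    using xy by (auto simp: facts astar_mult_idem astar_idem astar_props)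
  show "omul m (map_option (aplus S m) x) (map_option (aplus S m) y) =
      omul m (map_option (aplus S m) y) (map_option (aplus S m) x)"
    using xy by (auto simp: idem_commute[OF aplus_props(1) aplus_props(1)])
next
  fix x y z assume "x \<in> insert None (Some ` S)" "y \<in> insert None (Some ` S)" "z \<in> insert None (Some ` S)"
  then show "omul m (omul m x y) z = omul m x (omul m y z)" by (auto simp: assoc)
next
  fix x assume x: "x \<in> insert None (Some ` S)"
  show "omul m (map_option (aplus S m) x) x = x" using x by (auto simp: aplus_left)
  show "omul m x (map_option (astar S m) x) = x" using x by (auto simp: astar_right)
  show "map_option (aplus S m) (map_option (astar S m) x) = map_option (astar S m) x"
    using x by (auto simp: aplus_idem astar_props)
  show "map_option (astar S m) (map_option (aplus S m) x) = map_option (aplus S m) x"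
    using x by (auto simp: astar_idem aplus_props)
qed (auto simp: aplus_in astar_in)

end

lemma den_in_Tset: "set_trm t \<subseteq> Sig \<Longrightarrow> se (den t) \<noteq> {} \<Longrightarrow> cls (den t) \<in> Tset Sig"
  by (intro cls_in_Tset is_Sigma_tree_den)

lemma Tset_den:
  "A \<in> Tset Sig \<longleftrightarrow> (\<exists>t. set_trm t \<subseteq> Sig \<and> se (den t) \<noteq> {} \<and> A = cls (den t))"
proof
  assume "A \<in> Tset Sig"
  then obtain X where X: "A = cls X" "is_Sigma_tree Sig X" "se X \<noteq> {}" by (rule Tset_elim)
  then obtain t where "set_trm t \<subseteq> Sig" "heq (den t) X" using den_complete by blast
  then show "\<exists>t. set_trm t \<subseteq> Sig \<and> se (den t) \<noteq> {} \<and> A = cls (den t)"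
    using X heq_edges cls_eqI by metis
qed (use den_in_Tset in blast)

lemma cls_edgeless_prod:
  assumes "is_tree X" "is_tree Y" "se X = {}"
  shows "cls (tprod_u X Y) = cls Y" "cls (tprod_u Y X) = cls Y"
proof -
  have "heq X trivial_tree" by (rule heq_sym[OF edgeless_heq_trivial[OF assms(1,3)]])
  then show "cls (tprod_u X Y) = cls Y" "cls (tprod_u Y X) = cls Y"
    using heq_trans[OF heq_prod[OF _ heq_refl] heq_trivial_prod[OF assms(2)]]
      heq_trans[OF heq_prod[OF heq_refl] heq_prod_trivial[OF assms(2)]] cls_eqI by metis+
qed

locale generated = adequate_semigroup S m for S :: "'b set" and m +
  fixes Sig :: "'a set" and \<chi> :: "'a \<Rightarrow> 'b"
  assumes chi: "a \<in> Sig \<Longrightarrow> \<chi> a \<in> S"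
begin

text \<open>\<open>None\<close> is an adjoined identity, the value of the trivial tree; for letters outside \<open>Sig\<close> it is a
  dummy.\<close>
definition val :: "'a \<Rightarrow> 'b option" where
  "val a = (if a \<in> Sig then Some (\<chi> a) else None)"

sublocale evaluation "insert None (Some ` S)" "omul m" None "map_option (aplus S m)"
  "map_option (astar S m)" val
proof -
  interpret adequate_monoid "insert None (Some ` S)" "omul m" None "map_option (aplus S m)"
    "map_option (astar S m)"
    by (rule adequate_monoid_option)
  show "evaluation (insert None (Some ` S)) (omul m) None (map_option (aplus S m))
    (map_option (astar S m)) val"
    by unfold_locales (use chi in \<open>simp add: val_def\<close>)
qed

text \<open>A product is \<open>None\<close> only if both factors are, just as a product tree is
  edgeless only if both factors are.\<close>

lemma ev_eq_None_iff: "set_trm t \<subseteq> Sig \<Longrightarrow> ev t = None \<longleftrightarrow> se (den t) = {}"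
proof (induction t)
  case (Mul s t)
  then show ?case by (cases "ev s"; cases "ev t") auto
qed (auto simp: val_def)

lemma ev_the:
  assumes "set_trm t \<subseteq> Sig" "se (den t) \<noteq> {}"
  obtains x where "x \<in> S" "ev t = Some x"
  using assms ev_eq_None_iff[of t] ev_in[of t] by auto

definition extend :: "'a stree set \<Rightarrow> 'b" where
  "extend A = the (ev (SOME t. cls (den t) = A))"

text \<open>\<open>ev_heq\<close> makes the value independent of the term picked by
  \<open>SOME\<close>.\<close>

lemma extend_cls: "extend (cls (den t)) = the (ev t)"
proof -
  have "cls (den (SOME s. cls (den s) = cls (den t))) = cls (den t)"
    by (rule someI[of "\<lambda>s. cls (den s) = cls (den t)" t]) simp
  then have "heq (den (SOME s. cls (den s) = cls (den t))) (den t)"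
    using cls_eq_iff is_tree_den by blast
  then show ?thesis unfolding extend_def by (simp add: ev_heq)
qed

lemma extend_hom: "hom211 (Tset Sig) tmult tplus tstar S m (aplus S m) (astar S m) extend"
  unfolding hom211_def
proof (intro conjI ballI)
  fix A assume "A \<in> Tset Sig"
  then obtain s where s: "set_trm s \<subseteq> Sig" "se (den s) \<noteq> {}" "A = cls (den s)" by (auto simp: Tset_den)
  obtain x where x: "x \<in> S" "ev s = Some x" by (rule ev_the[OF s(1,2)])
  show "extend A \<in> S" using s(3) x by (simp add: extend_cls)
  show "extend (tplus A) = aplus S m (extend A)"
    using extend_cls[of "Plus s"] s(3) x by (simp add: extend_cls tplus_cls is_tree_den)
  show "extend (tstar A) = astar S m (extend A)"
    using extend_cls[of "Star s"] s(3) x by (simp add: extend_cls tstar_cls is_tree_den)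
  fix B assume "B \<in> Tset Sig"
  then obtain t where t: "set_trm t \<subseteq> Sig" "se (den t) \<noteq> {}" "B = cls (den t)" by (auto simp: Tset_den)
  obtain y where y: "y \<in> S" "ev t = Some y" by (rule ev_the[OF t(1,2)])
  show "extend (tmult A B) = m (extend A) (extend B)"
    using extend_cls[of "Mul s t"] s(3) t(3) x y by (simp add: extend_cls tmult_cls is_tree_den)
qed

lemma extend_base: "a \<in> Sig \<Longrightarrow> extend (base_type a) = \<chi> a"
  using extend_cls[of "Gen a"] by (simp add: base_type_cls val_def)

text \<open>\<open>\<psi>\<close> is controlled only on \<open>Tset Sig\<close>, hence not at
  edgeless subterms. In a product such a factor is dropped on both sides: by
  \<open>cls_edgeless_prod\<close> for trees, and as \<open>None\<close> for values.\<close>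

lemma hom_eq_ev:
  assumes h: "hom211 (Tset Sig) tmult tplus tstar S m (aplus S m) (astar S m) \<psi>"
    and b: "\<forall>a \<in> Sig. \<psi> (base_type a) = \<chi> a"
  shows "set_trm t \<subseteq> Sig \<Longrightarrow> se (den t) \<noteq> {} \<Longrightarrow> ev t = Some (\<psi> (cls (den t)))"
proof (induction t)
  case (Mul s t)
  have st: "set_trm s \<subseteq> Sig" "set_trm t \<subseteq> Sig" using Mul.prems by auto
  consider "se (den s) = {}" | "se (den t) = {}" | "se (den s) \<noteq> {}" "se (den t) \<noteq> {}" by blast
  then show ?case
  proof cases
    case 1
    then have "ev s = None" "se (den t) \<noteq> {}" using Mul.prems ev_eq_None_iff[OF st(1)] by auto
    then show ?thesis using Mul.IH(2)[OF st(2)] cls_edgeless_prod(1)[OF is_tree_den is_tree_den 1, of t] by simp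
  next
    case 2
    then have "ev t = None" "se (den s) \<noteq> {}" using Mul.prems ev_eq_None_iff[OF st(2)] by auto
    then show ?thesis using Mul.IH(1)[OF st(1)] cls_edgeless_prod(2)[OF is_tree_den is_tree_den 2, of s] by simp
  next
    case 3
    then have "cls (den s) \<in> Tset Sig" "cls (den t) \<in> Tset Sig" using st Tset_den by blast+
    then have "\<psi> (tmult (cls (den s)) (cls (den t))) = m (\<psi> (cls (den s))) (\<psi> (cls (den t)))"
      using h by (simp add: hom211_def)
    then show ?thesis using 3 Mul.IH st by (simp add: tmult_cls is_tree_den)
  qed
next
  case (Plus t)
  then have "cls (den t) \<in> Tset Sig" using den_in_Tset[of t] by simp
  then have "\<psi> (tplus (cls (den t))) = aplus S m (\<psi> (cls (den t)))" using h by (simp add: hom211_def)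
  then show ?case using Plus by (simp add: tplus_cls is_tree_den)
next
  case (Star t)
  then have "cls (den t) \<in> Tset Sig" using den_in_Tset[of t] by simp
  then have "\<psi> (tstar (cls (den t))) = astar S m (\<psi> (cls (den t)))" using h by (simp add: hom211_def)
  then show ?case using Star by (simp add: tstar_cls is_tree_den)
qed (use b in \<open>auto simp: val_def base_type_cls\<close>)

lemma extend_unique:
  assumes "hom211 (Tset Sig) tmult tplus tstar S m (aplus S m) (astar S m) \<psi>"
    and "\<forall>a \<in> Sig. \<psi> (base_type a) = \<chi> a" "A \<in> Tset Sig"
  shows "\<psi> A = extend A"
proof -
  obtain t where t: "set_trm t \<subseteq> Sig" "se (den t) \<noteq> {}" "A = cls (den t)"
    using assms(3) by (auto simp: Tset_den)
  then show ?thesis using hom_eq_ev[OF assms(1,2) t(1,2)] by (simp add: extend_cls)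
qed

end

theorem theorem5p16:
  fixes Sig :: "'a set"
  shows "adequate (Tset Sig) tmult \<and>
    (\<forall>A \<in> Tset Sig. aplus (Tset Sig) tmult A = tplus A \<and>
                    astar (Tset Sig) tmult A = tstar A) \<and>
    (\<forall>a \<in> Sig. base_type a \<in> Tset Sig) \<and>
    (\<forall>(S :: 'b set) m \<chi>. adequate S m \<longrightarrow> (\<forall>a \<in> Sig. \<chi> a \<in> S) \<longrightarrow>
       (\<exists>\<phi>. hom211 (Tset Sig) tmult tplus tstar S m (aplus S m) (astar S m) \<phi> \<and>
            (\<forall>a \<in> Sig. \<phi> (base_type a) = \<chi> a) \<and>
            (\<forall>\<psi>. hom211 (Tset Sig) tmult tplus tstar S m (aplus S m) (astar S m) \<psi> \<and>
                  (\<forall>a \<in> Sig. \<psi> (base_type a) = \<chi> a) \<longrightarrow>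
                  (\<forall>A \<in> Tset Sig. \<psi> A = \<phi> A))))"
proof (intro conjI allI impI)
  show "adequate (Tset Sig) tmult" by (rule adequate_Tset)
  show "\<forall>A \<in> Tset Sig. aplus (Tset Sig) tmult A = tplus A \<and> astar (Tset Sig) tmult A = tstar A"
    by (simp add: aplus_Tset astar_Tset)
  show "\<forall>a \<in> Sig. base_type a \<in> Tset Sig" by (simp add: base_type_in_Tset)
next
  fix S :: "'b set" and m \<chi>
  assume "adequate S m" "\<forall>a \<in> Sig. \<chi> a \<in> S"
  then interpret generated S m Sig \<chi>
    by (simp add: generated_def generated_axioms_def adequate_semigroup_def)
  show "\<exists>\<phi>. hom211 (Tset Sig) tmult tplus tstar S m (aplus S m) (astar S m) \<phi> \<and>
      (\<forall>a \<in> Sig. \<phi> (base_type a) = \<chi> a) \<and>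
      (\<forall>\<psi>. hom211 (Tset Sig) tmult tplus tstar S m (aplus S m) (astar S m) \<psi> \<and>
            (\<forall>a \<in> Sig. \<psi> (base_type a) = \<chi> a) \<longrightarrow> (\<forall>A \<in> Tset Sig. \<psi> A = \<phi> A))"
    by (intro exI[of _ extend] conjI allI impI ballI extend_hom extend_base) (auto intro: extend_unique)
qed

end
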